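(* Assume that the algebra of $2\times2$ (real or complex) upper triangular matrices is endowed with an $\ell^p$ operator norm $\|\cdot\|_{\ell^p}$, $1\le p\le+\infty$, or even just with any algebra norm $\|\cdot\|$ such that $\left\|\begin{bmatrix}1&0\\0&-1\end{bmatrix}\right\|=1$. For $-\pi\le\alpha\le\pi$ and $\varepsilon\ne0$ let $$M_1^{[\alpha,\varepsilon]}=\begin{bmatrix}\frac{\pi-\alpha}2&-\frac{\pi+\alpha}2\varepsilon\\0&-\frac{\pi-\alpha}2\end{bmatrix},\qquad M_2^{[\alpha,\varepsilon]}=\begin{bmatrix}\frac{\pi+\alpha}2&\frac{\pi-\alpha}2\varepsilon\\0&-\frac{\pi+\alpha}2\end{bmatrix}.$$ Let $r>0$ and $\delta>0$. Then: (a) There exist $\alpha\in[-\pi,\pi]$ and $\varepsilon\neq0$ such that $\|M_1^{[\alpha,\varepsilon]}\|:\|M_2^{[\alpha,\varepsilon]}\|=r$ and $\|M_1^{[\alpha,\varepsilon]}\|+\|M_2^{[\alpha,\varepsilon]}\|<\pi+\delta$, and the Magnus (BCH) series of the ordered measure $M_1^{[\alpha,\varepsilon]}\mathbf 1_{[0,1)}\boldsymbol.M_2^{[\alpha,\varepsilon]}\mathbf 1_{[1,2)}$ is not absolutely convergent. (b) There exist upper triangular $2\times 2$ matrices $M_1,M_2$ such that $\|M_1\|:\|M_2\|=r$, $\|M_1\|+\|M_2\|=\pi+\delta$, the Magnus expansion of $M_1\mathbf 1_{[0,1)}\boldsymbol.M_2\mathbf 1_{[1,2)}$ is not convergent, and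 moreover the terms $\mu_{k,\mathrm R}\left(M_1\mathbf 1_{[0,1)}\boldsymbol.M_2\mathbf 1_{[1,2)}\right)$, $k\ge1$, of the Magnus expansion are unbounded.
   Context: An algebra norm is a submultiplicative norm. $M_1\mathbf 1_{[0,1)}\boldsymbol.M_2\mathbf 1_{[1,2)}$ denotes the matrix-valued ordered measure on $[0,2)$ with density $M_1$ on $[0,1)$ and $M_2$ on $[1,2)$. Magnus terms: for a matrix-valued atomless measure $\phi$ of finite variation on an interval $I$, and $t_1,\dots,t_k\in I$, let $\mathrm{asc}$ (resp. $\mathrm{des}$) be the number of $i<k$ with $t_i<t_{i+1}$ (resp. $t_i>t_{i+1}$). Then $$\mu_{k,\mathrm R}(\phi)=\int_{(t_1,\dots,t_k)\in I^k}(-1)^{\mathrm{des}(t_1,\dots,t_k)}\frac{\mathrm{asc}(t_1,\dots,t_k)!\,\mathrm{des}(t_1,\dots,t_k)!}{k!}\,\phi(t_1)\cdots\phi(t_k).$$ For $\phi=M_1\mathbf 1_{[0,1)}\boldsymbol.M_2\mathbf 1_{[1,2)}$ this is the degree $k$ homogeneous part of the Baker--Campbell--Hausdorff (BCH) series, i.e. $\sum_kt^k\mu_{k,\mathrm R}(\phi)=\log(\exp(tM_1)\exp(tM_2))$ as formal power series in $t$. The Magnus expansion (series) of $\phi$ is $\sum_{k\ge1}\mu_{k,\mathrm R}(\phi)$. *)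

theory Defs
  imports "HOL-Analysis.Analysis"
begin

text \<open>
  Square matrices are of type \<open>'a ^ 2 ^ 2\<close>, with matrix product \<open>**\<close>. The scalars range over
  the sort \<open>{real_normed_field, euclidean_space}\<close>, which has the instances
  \<open>real\<close> and \<open>complex\<close>; by Gelfand--Mazur these are its only models up to isomorphism.
\<close>

definition upper_triangular :: "('a::zero ^ 2 ^ 2) set" where
  "upper_triangular = {A. A $ 2 $ 1 = 0}"

definition mat22 :: "'a::zero \<Rightarrow> 'a \<Rightarrow> 'a \<Rightarrow> 'a \<Rightarrow> 'a ^ 2 ^ 2" where
  "mat22 a b c d = vector [vector [a, b], vector [c, d]]"

text \<open>A submultiplicative norm on the algebra \<open>S\<close>; \<open>N (mat 1) = 1\<close> is not required.
  Values of \<open>N\<close> outside \<open>S\<close> are irrelevant. The matrix \<open>\<chi> i j. c * A $ i $ j\<close> is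
  the scalar multiple of \<open>A\<close> by \<open>c\<close>, as \<open>*\<^sub>R\<close> covers only real scalars.\<close>

definition algebra_norm_on ::
  "('a::real_normed_field ^ 'n ^ 'n) set \<Rightarrow> ('a ^ 'n ^ 'n \<Rightarrow> real) \<Rightarrow> bool" where
  "algebra_norm_on S N \<longleftrightarrow>
     (\<forall>A\<in>S. 0 \<le> N A) \<and>
     (\<forall>A\<in>S. N A = 0 \<longleftrightarrow> A = 0) \<and>
     (\<forall>A\<in>S. \<forall>B\<in>S. N (A + B) \<le> N A + N B) \<and>
     (\<forall>c. \<forall>A\<in>S. N (\<chi> i j. c * A $ i $ j) = norm c * N A) \<and>
     (\<forall>A\<in>S. \<forall>B\<in>S. N (A ** B) \<le> N A * N B)"

definition lp_norm :: "ereal \<Rightarrow> 'a::real_normed_field ^ 'n \<Rightarrow> real" where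
  "lp_norm p v =
     (if p = \<infinity> then Max (range (\<lambda>i. norm (v $ i)))
      else (\<Sum>i\<in>UNIV. norm (v $ i) powr real_of_ereal p) powr (1 / real_of_ereal p))"

definition lp_operator_norm :: "ereal \<Rightarrow> 'a::real_normed_field ^ 'n ^ 'n \<Rightarrow> real" where
  "lp_operator_norm p A = (SUP v\<in>{v. v \<noteq> 0}. lp_norm p (A *v v) / lp_norm p v)"

text \<open>Only the values \<open>t 0, \<dots>, t (k - 1)\<close> enter: the tuple \<open>(t\<^sub>1, \<dots>, t\<^sub>k)\<close> is indexed from 0.\<close>

definition asc :: "nat \<Rightarrow> (nat \<Rightarrow> real) \<Rightarrow> nat" where
  "asc k t = card {i. Suc i < k \<and> t i < t (Suc i)}"

definition des :: "nat \<Rightarrow> (nat \<Rightarrow> real) \<Rightarrow> nat" where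
  "des k t = card {i. Suc i < k \<and> t i > t (Suc i)}"

text \<open>The ordered product \<open>h (t 0) ** \<dots> ** h (t (k - 1))\<close>.\<close>

definition ordered_product ::
  "(real \<Rightarrow> 'a::semiring_1 ^ 'n ^ 'n) \<Rightarrow> nat \<Rightarrow> (nat \<Rightarrow> real) \<Rightarrow> 'a ^ 'n ^ 'n" where
  "ordered_product h k t = foldr (\<lambda>i B. h (t i) ** B) [0..<k] (mat 1)"

text \<open>A matrix-valued measure \<open>\<phi>\<close> of finite variation on \<open>I\<close> is represented as
  \<open>d\<phi> = h dM\<close>, with \<open>M\<close> a finite (atomless) measure with space \<open>I\<close> and \<open>h\<close> an integrable
  density. The integral against \<open>\<phi>(t\<^sub>1) \<cdots> \<phi>(t\<^sub>k)\<close> over \<open>I\<^sup>k\<close> is then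
  a Bochner integral with respect to the \<open>k\<close>-fold product of \<open>M\<close>.\<close>

definition magnus_term ::
  "real measure \<Rightarrow> (real \<Rightarrow> 'a::{real_normed_field, euclidean_space} ^ 'n ^ 'n) \<Rightarrow> nat \<Rightarrow>
    'a ^ 'n ^ 'n" where
  "magnus_term M h k =
     (\<integral>t. ((-1) ^ des k t * (fact (asc k t) * fact (des k t) / fact k)) *\<^sub>R
        ordered_product h k t \<partial>(\<Pi>\<^sub>M i\<in>{..<k}. M))"

text \<open>The Magnus terms of the measure on \<open>[0, 2)\<close> with Lebesgue density \<open>A\<close> on \<open>[0, 1)\<close> and
  \<open>B\<close> on \<open>[1, 2)\<close>.\<close>

definition bch_term ::
  "'a::{real_normed_field, euclidean_space} ^ 'n ^ 'n \<Rightarrow> 'a ^ 'n ^ 'n \<Rightarrow> nat \<Rightarrow> 'a ^ 'n ^ 'n" where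
  "bch_term A B = magnus_term (restrict_space lborel {0..<2}) (\<lambda>t. if t < 1 then A else B)"

definition M1 :: "real \<Rightarrow> real \<Rightarrow> 'a::real_normed_field ^ 2 ^ 2" where
  "M1 \<alpha> \<epsilon> = mat22 (of_real ((pi - \<alpha>) / 2)) (of_real (- ((pi + \<alpha>) / 2 * \<epsilon>)))
                 0 (of_real (- ((pi - \<alpha>) / 2)))"

definition M2 :: "real \<Rightarrow> real \<Rightarrow> 'a::real_normed_field ^ 2 ^ 2" where
  "M2 \<alpha> \<epsilon> = mat22 (of_real ((pi + \<alpha>) / 2)) (of_real ((pi - \<alpha>) / 2 * \<epsilon>))
                 0 (of_real (- ((pi + \<alpha>) / 2)))"

text \<open>Convergence, absolute convergence and boundedness are all with respect to the given
  norm \<open>N\<close> on \<open>S\<close>, for series whose terms are indexed by \<open>k \<ge> 1\<close>.\<close>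

definition series_converges_on ::
  "('b::ab_group_add) set \<Rightarrow> ('b \<Rightarrow> real) \<Rightarrow> (nat \<Rightarrow> 'b) \<Rightarrow> bool" where
  "series_converges_on S N \<mu> \<longleftrightarrow> (\<exists>L\<in>S. (\<lambda>n. N ((\<Sum>k = 1..n. \<mu> k) - L)) \<longlonglongrightarrow> 0)"

definition series_abs_converges :: "('b \<Rightarrow> real) \<Rightarrow> (nat \<Rightarrow> 'b) \<Rightarrow> bool" where
  "series_abs_converges N \<mu> \<longleftrightarrow> summable (\<lambda>k. N (\<mu> (Suc k)))"

definition terms_bounded :: "('b \<Rightarrow> real) \<Rightarrow> (nat \<Rightarrow> 'b) \<Rightarrow> bool" where
  "terms_bounded N \<mu> \<longleftrightarrow> (\<exists>C. \<forall>k\<ge>1. N (\<mu> k) \<le> C)"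

end

(* The Magnus weight (-1)^des asc! des! / k! is, away from ties, the Beta integral over x in [0,1]
   of x^asc (x-1)^des, a product of kernels K_x(t_i, t_{i+1}) with K_x(s,y) = x for s < y and x - 1
   for s > y. So each Magnus term is the x-average of an iterated integral, and for small real z the
   generating function of these iterated integrals is obtained from a solution Phi of the equation
   Phi = v + z T_x Phi, (T_x Phi)(s) = \<integral> K_x(s,y) h(y) Phi(y) dy, h being the density.
   Since K_x jumps by 1 on the diagonal, this is the differential equation Phi' = - z h Phi with the
   boundary condition (1-x) Phi(0) + x Phi(2) = v, which is explicitly solvable for triangular h.
   Averaging over x shows that the off-diagonal entries y_k of the Magnus terms satisfy
     (sum_k y_{k+1} z^k) (exp(cz) - exp(-cz)) = 2 c X(z)
   with X an explicit combination of exponentials and c = a + b the sum of the (1,1) entries.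
   For c = pi the left-hand factor vanishes at z = i while X(i) does not, so the y_k are not absolutely
   summable. The intermediate value theorem in alpha adjusts the ratio of the norms, for epsilon so
   small that the sum of the norms stays below pi + delta; scaling up to sum pi + delta turns the lack
   of absolute convergence into unbounded terms. *)

theory Submission
  imports Defs
begin

section \<open>Operator norms of \<open>\<ell>\<^sup>p\<close>\<close>

text \<open>The origin of pi: \<open>exp (z A) exp (z B)\<close> has eigenvalues exp(cz) and
  exp(-cz) and off-diagonal entry X(z), so the off-diagonal entry of its logarithm is X(z) times the
  divided difference 2cz / (exp(cz) - exp(-cz)) of log. The two eigenvalues meet at a nonzero z of
  the closed unit disc only once c reaches pi; at z = i they are both -1, and X(i) \<noteq> 0 makes
  the product a nontrivial Jordan block, where the divided difference has a pole. The obstacle: the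
  integral equation is solved by iteration only for small real z, while the pole sits on the unit
  circle. No analytic continuation is used. Assuming absolute summability, the identity for small z
  is turned into an identity of Taylor coefficients, which is then summed again at z = i. Up to a
  nonzero factor, X(i) is (u/(2a) - v/(2b)) (exp(i(a - b)) + 1). The second factor is nonzero
  because a, b > 0, so the intermediate value argument must place \<alpha> strictly inside the
  interval.\<close>

lemma powr_convex_nonneg:
  fixes x y u v q :: real
  assumes "1 \<le> q" "0 \<le> x" "0 \<le> y" "0 \<le> u" "0 \<le> v" "u + v = 1"
  shows "(u * x + v * y) powr q \<le> u * x powr q + v * y powr q"
proof -
  \<comment> \<open>For \<open>x = 0\<close> or \<open>y = 0\<close> convexity amounts to
    \<open>w powr q \<le> w\<close> on [0, 1].\<close>
  have le: "(w * z) powr q \<le> w * z powr q" if "0 \<le> w" "w \<le> 1" "0 \<le> z" for w z :: real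
  proof -
    have "w powr q \<le> w"
    proof (cases "w = 0")
      case False
      then have "w powr q \<le> w powr 1" using that assms(1) by (intro powr_mono') auto
      then show ?thesis using that False by simp
    qed simp
    then show ?thesis using that by (simp add: powr_mult mult_right_mono)
  qed
  consider "x = 0" | "y = 0" | "0 < x" "0 < y" using assms by linarith
  then show ?thesis
  proof cases
    case 3
    have "u = 1 - v" using assms by simp
    with 3 show ?thesis
      using convex_onD[OF powr_convex[OF assms(1)], of v x y] assms(4,5) by simp
  qed (use le[of v y] le[of u x] assms in auto)
qed

text \<open>After division by a + b, each term \<open>f i + g i\<close> is a convex combination of
  \<open>f i / a\<close> and \<open>g i / b\<close> with weights a/(a + b) and b/(a + b). Convexity
  of the power is applied termwise, and the q-th powers of both normalised families sum to
  1.\<close>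

lemma Minkowski_sum:
  fixes f g :: "'n \<Rightarrow> real" and q :: real
  assumes S: "finite S" and q: "1 \<le> q" and f: "\<And>i. 0 \<le> f i" and g: "\<And>i. 0 \<le> g i"
  shows "(\<Sum>i\<in>S. (f i + g i) powr q) powr (1 / q) \<le>
    (\<Sum>i\<in>S. f i powr q) powr (1 / q) + (\<Sum>i\<in>S. g i powr q) powr (1 / q)"
proof -
  define a where "a = (\<Sum>i\<in>S. f i powr q) powr (1 / q)"
  define b where "b = (\<Sum>i\<in>S. g i powr q) powr (1 / q)"
  have aq: "a powr q = (\<Sum>i\<in>S. f i powr q)" and bq: "b powr q = (\<Sum>i\<in>S. g i powr q)"
    unfolding a_def b_def using q by (simp_all add: powr_powr sum_nonneg)
  have ab: "0 \<le> a" "0 \<le> b" by (auto simp: a_def b_def)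
  show ?thesis
  proof (cases "a = 0 \<or> b = 0")
    case True
    then have "(\<forall>i\<in>S. f i = 0) \<or> (\<forall>i\<in>S. g i = 0)"
      using aq bq q S by (auto simp: sum_nonneg_eq_0_iff)
    then show ?thesis
    proof
      assume "\<forall>i\<in>S. f i = 0"
      then have "(\<Sum>i\<in>S. (f i + g i) powr q) = (\<Sum>i\<in>S. g i powr q)" by (intro sum.cong) auto
      then show ?thesis by simp
    next
      assume "\<forall>i\<in>S. g i = 0"
      then have "(\<Sum>i\<in>S. (f i + g i) powr q) = (\<Sum>i\<in>S. f i powr q)" by (intro sum.cong) auto
      then show ?thesis by simp
    qed
  next
    case False
    then have pos: "0 < a" "0 < b" using ab by auto
    have *: "((f i + g i) / (a + b)) powr q
        \<le> a / (a + b) * (f i powr q / a powr q) + b / (a + b) * (g i powr q / b powr q)" for i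
    proof -
      have "(f i + g i) / (a + b) = a / (a + b) * (f i / a) + b / (a + b) * (g i / b)"
        using pos by (simp add: add_divide_distrib)
      then show ?thesis
        using powr_convex_nonneg[OF q, of "f i / a" "g i / b" "a / (a + b)" "b / (a + b)"] pos f[of i] g[of i]
        by (simp add: powr_divide add_divide_distrib[symmetric])
    qed
    have "(\<Sum>i\<in>S. ((f i + g i) / (a + b)) powr q)
        \<le> (\<Sum>i\<in>S. a / (a + b) * (f i powr q / a powr q) + b / (a + b) * (g i powr q / b powr q))"
      by (rule sum_mono) (rule *)
    also have "\<dots> = a / (a + b) * ((\<Sum>i\<in>S. f i powr q) / a powr q) + b / (a + b) * ((\<Sum>i\<in>S. g i powr q) / b powr q)"
      by (simp only: sum.distrib sum_distrib_left[symmetric] sum_divide_distrib[symmetric])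
    also have "\<dots> = a / (a + b) + b / (a + b)"
      using pos by (simp flip: aq bq)
    also have "\<dots> = 1" using pos by (simp add: add_divide_distrib[symmetric])
    finally have "(\<Sum>i\<in>S. (f i + g i) powr q) / (a + b) powr q \<le> 1"
      using f g pos by (simp add: powr_divide sum_divide_distrib)
    then have "(\<Sum>i\<in>S. (f i + g i) powr q) \<le> (a + b) powr q"
      using pos by (simp add: divide_simps)
    then have "(\<Sum>i\<in>S. (f i + g i) powr q) powr (1 / q) \<le> ((a + b) powr q) powr (1 / q)"
      using q by (intro powr_mono2) (auto intro: sum_nonneg)
    also have "\<dots> = a + b" using q pos by (simp add: powr_powr)
    finally show ?thesis unfolding a_def b_def .
  qed
qed

section \<open>The \<ell>^p norms of vectors\<close>

lemma ereal_ge_1_cases: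
  fixes p :: ereal
  assumes "1 \<le> p"
  obtains "p = \<infinity>" | q where "p = ereal q" "1 \<le> q"
  using assms by (cases p) (auto simp: one_ereal_def)

lemma lp_norm_infinity: "lp_norm \<infinity> v = Max (range (\<lambda>i. norm (v $ i)))"
  by (simp add: lp_norm_def)

lemma lp_norm_ereal: "lp_norm (ereal q) v = (\<Sum>i\<in>UNIV. norm (v $ i) powr q) powr (1 / q)"
  by (simp add: lp_norm_def)

lemma norm_le_lp_norm:
  assumes "1 \<le> p"
  shows "norm (v $ i) \<le> lp_norm p v"
  using assms
proof (cases rule: ereal_ge_1_cases)
  case 1
  then show ?thesis by (auto simp: lp_norm_infinity intro: Max_ge)
next
  case (2 q)
  have "norm (v $ i) powr q \<le> (\<Sum>i\<in>UNIV. norm (v $ i) powr q)"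
    by (rule member_le_sum) auto
  then have "(norm (v $ i) powr q) powr (1 / q) \<le> (\<Sum>i\<in>UNIV. norm (v $ i) powr q) powr (1 / q)"
    using 2 by (intro powr_mono2) auto
  then show ?thesis using 2 by (simp add: lp_norm_ereal powr_powr)
qed

lemma lp_norm_nonneg: "1 \<le> p \<Longrightarrow> 0 \<le> lp_norm p v"
  using norm_le_lp_norm[of p v undefined] norm_ge_zero order_trans by blast

lemma lp_norm_cong: "(\<And>i. norm (v $ i) = norm (w $ i)) \<Longrightarrow> lp_norm p v = lp_norm p w"
  by (simp add: lp_norm_def)

lemma lp_norm_zero [simp]: "1 \<le> p \<Longrightarrow> lp_norm p 0 = 0"
  by (erule ereal_ge_1_cases) (auto simp: lp_norm_infinity lp_norm_ereal)

lemma lp_norm_eq_0_iff: "1 \<le> p \<Longrightarrow> lp_norm p v = 0 \<longleftrightarrow> v = 0"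
  using norm_le_lp_norm[of p v] lp_norm_zero[of p] by (metis norm_le_zero_iff vec_eq_iff zero_index)

lemma lp_norm_pos: "1 \<le> p \<Longrightarrow> v \<noteq> 0 \<Longrightarrow> 0 < lp_norm p v"
  using lp_norm_eq_0_iff lp_norm_nonneg by (metis less_eq_real_def)

lemma lp_norm_scale:
  assumes "1 \<le> p"
  shows "lp_norm p (c *s v) = norm c * lp_norm p v"
  using assms
proof (cases rule: ereal_ge_1_cases)
  case 1
  have "Max (range (\<lambda>i. norm c * norm (v $ i))) = Max ((\<lambda>x. norm c * x) ` range (\<lambda>i. norm (v $ i)))"
    by (simp add: image_image)
  also have "\<dots> = norm c * Max (range (\<lambda>i. norm (v $ i)))"
    by (rule mono_Max_commute[symmetric]) (auto simp: mono_def mult_left_mono)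
  finally show ?thesis using 1 by (simp add: lp_norm_infinity norm_mult)
next
  case (2 q)
  have "(\<Sum>i\<in>UNIV. norm ((c *s v) $ i) powr q) = norm c powr q * (\<Sum>i\<in>UNIV. norm (v $ i) powr q)"
    by (simp add: norm_mult powr_mult sum_distrib_left)
  then show ?thesis using 2 by (simp add: lp_norm_ereal powr_mult powr_powr sum_nonneg)
qed

lemma lp_norm_triangle:
  assumes "1 \<le> p"
  shows "lp_norm p (v + w) \<le> lp_norm p v + lp_norm p w"
  using assms
proof (cases rule: ereal_ge_1_cases)
  case 1
  have "norm ((v + w) $ i) \<le> lp_norm p v + lp_norm p w" for i
    using norm_triangle_ineq[of "v $ i" "w $ i"] norm_le_lp_norm[OF assms, of v i]
      norm_le_lp_norm[OF assms, of w i] by simp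
  then show ?thesis using 1 by (simp add: lp_norm_infinity)
next
  case (2 q)
  have "(\<Sum>i\<in>UNIV. norm ((v + w) $ i) powr q) powr (1 / q)
      \<le> (\<Sum>i\<in>UNIV. (norm (v $ i) + norm (w $ i)) powr q) powr (1 / q)"
    using 2 by (intro powr_mono2 sum_mono sum_nonneg) (auto intro: norm_triangle_ineq)
  also have "\<dots> \<le> lp_norm p v + lp_norm p w"
    using Minkowski_sum[of UNIV q "\<lambda>i. norm (v $ i)" "\<lambda>i. norm (w $ i)"] 2 by (simp add: lp_norm_ereal)
  finally show ?thesis using 2 by (simp add: lp_norm_ereal)
qed

lemma lp_norm_sum: "1 \<le> p \<Longrightarrow> lp_norm p (\<Sum>j\<in>S. f j) \<le> (\<Sum>j\<in>S. lp_norm p (f j))"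
  by (induction S rule: infinite_finite_induct)
     (auto intro: order_trans[OF lp_norm_triangle])

text \<open>A crude estimate that makes the supremum in \<open>lp_operator_norm\<close> one over a
  bounded set: \<open>A *v v\<close> combines the columns of \<open>A\<close> with coefficients of
  modulus at most \<open>lp_norm p v\<close>.\<close>

lemma lp_norm_matrix_bound:
  fixes A :: "'a::real_normed_field ^ 'n ^ 'n"
  assumes "1 \<le> p"
  shows "lp_norm p (A *v v) \<le> (\<Sum>j\<in>UNIV. lp_norm p (column j A)) * lp_norm p v"
proof -
  have "lp_norm p (A *v v) \<le> (\<Sum>j\<in>UNIV. lp_norm p ((v $ j) *s column j A))"
    unfolding matrix_mult_sum by (rule lp_norm_sum[OF assms])
  also have "\<dots> \<le> (\<Sum>j\<in>UNIV. lp_norm p v * lp_norm p (column j A))"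
    unfolding lp_norm_scale[OF assms]
    by (intro sum_mono mult_right_mono norm_le_lp_norm lp_norm_nonneg assms)
  finally show ?thesis by (simp add: sum_distrib_left mult.commute)
qed

section \<open>The operator norm as the least Lipschitz constant\<close>

lemma lp_operator_norm_apply:
  fixes A :: "'a::real_normed_field ^ 'n ^ 'n"
  assumes "1 \<le> p"
  shows "lp_norm p (A *v v) \<le> lp_operator_norm p A * lp_norm p v"
proof (cases "v = 0")
  case True
  then show ?thesis using assms by simp
next
  case False
  have "bdd_above ((\<lambda>v. lp_norm p (A *v v) / lp_norm p v) ` {v. v \<noteq> 0})"
    using lp_norm_matrix_bound[OF assms, of A] assms
    by (intro bdd_aboveI2[of _ _ "\<Sum>j\<in>UNIV. lp_norm p (column j A)"]) (auto simp: pos_divide_le_eq[OF lp_norm_pos])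
  then have "lp_norm p (A *v v) / lp_norm p v \<le> lp_operator_norm p A"
    unfolding lp_operator_norm_def using False by (intro cSUP_upper) auto
  then show ?thesis using lp_norm_pos[OF assms False] by (simp add: divide_simps)
qed

lemma lp_operator_norm_least:
  fixes A :: "'a::real_normed_field ^ 'n ^ 'n"
  assumes "1 \<le> p" "\<And>v. lp_norm p (A *v v) \<le> K * lp_norm p v"
  shows "lp_operator_norm p A \<le> K"
  unfolding lp_operator_norm_def
proof (rule cSUP_least)
  \<comment> \<open>Index types are nonempty, so \<open>undefined\<close> names some coordinate and
    its unit vector is a nonzero vector.\<close>
  have "axis undefined 1 \<in> {v :: 'a ^ 'n. v \<noteq> 0}" by (simp add: axis_eq_0_iff)
  then show "{v :: 'a ^ 'n. v \<noteq> 0} \<noteq> {}" by blast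
qed (use assms in \<open>auto simp: pos_divide_le_eq[OF lp_norm_pos]\<close>)

lemma lp_operator_norm_nonneg:
  fixes A :: "'a::real_normed_field ^ 'n ^ 'n"
  assumes "1 \<le> p"
  shows "0 \<le> lp_operator_norm p A"
proof -
  have "(axis undefined 1 :: 'a ^ 'n) \<noteq> 0" by (simp add: axis_eq_0_iff)
  then show ?thesis
    using lp_operator_norm_apply[OF assms, of A "axis undefined 1"] lp_norm_pos[OF assms]
      lp_norm_nonneg[OF assms, of "A *v axis undefined 1"]
    by (metis order_trans zero_le_mult_iff not_less)
qed

text \<open>Together with \<open>lp_operator_norm_diag\<close> this reduces the \<ell>^p alternative
  of the theorem to the one about algebra norms.\<close>

lemma algebra_norm_on_lp_operator_norm:
  assumes p: "1 \<le> p"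
  shows "algebra_norm_on S (lp_operator_norm p :: 'a::real_normed_field ^ 'n ^ 'n \<Rightarrow> real)"
  unfolding algebra_norm_on_def
proof (intro conjI ballI allI)
  fix A B :: "'a ^ 'n ^ 'n" and c :: 'a
  let ?N = "lp_operator_norm p :: 'a ^ 'n ^ 'n \<Rightarrow> real"
  show "0 \<le> ?N A" by (rule lp_operator_norm_nonneg[OF p])
  show "?N A = 0 \<longleftrightarrow> A = 0"
  proof
    assume "?N A = 0"
    then have "lp_norm p (A *v v) \<le> 0" for v
      using lp_operator_norm_apply[OF p, of A v] by simp
    then have "A *v v = 0" for v
      using lp_norm_nonneg[OF p, of "A *v v"] lp_norm_eq_0_iff[OF p, of "A *v v"] by (metis order_antisym)
    then show "A = 0" by (simp add: matrix_eq)
  next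
    assume "A = 0"
    then have "?N A \<le> 0" by (intro lp_operator_norm_least[OF p]) (simp add: p)
    then show "?N A = 0" using lp_operator_norm_nonneg[OF p, of A] by simp
  qed
  show "?N (A + B) \<le> ?N A + ?N B"
  proof (rule lp_operator_norm_least[OF p])
    fix v
    have "lp_norm p ((A + B) *v v) \<le> lp_norm p (A *v v) + lp_norm p (B *v v)"
      by (simp add: matrix_vector_mult_add_rdistrib lp_norm_triangle[OF p])
    also have "\<dots> \<le> ?N A * lp_norm p v + ?N B * lp_norm p v"
      by (intro add_mono lp_operator_norm_apply p)
    finally show "lp_norm p ((A + B) *v v) \<le> (?N A + ?N B) * lp_norm p v" by (simp add: algebra_simps)
  qed
  have le: "?N (\<chi> i j. c * A $ i $ j) \<le> norm c * ?N A" for c A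
  proof (rule lp_operator_norm_least[OF p])
    fix v
    have "(\<chi> i j. c * A $ i $ j) *v v = c *s (A *v v)"
      by (simp add: vec_eq_iff matrix_vector_mult_def sum_distrib_left mult.assoc)
    then show "lp_norm p ((\<chi> i j. c * A $ i $ j) *v v) \<le> norm c * ?N A * lp_norm p v"
      using mult_left_mono[OF lp_operator_norm_apply[OF p, of A v] norm_ge_zero[of c]]
      by (simp add: lp_norm_scale[OF p] mult.assoc)
  qed
  show "?N (\<chi> i j. c * A $ i $ j) = norm c * ?N A"
  proof (cases "c = 0")
    case True
    then show ?thesis using le[of c A] lp_operator_norm_nonneg[OF p, of "\<chi> i j. c * A $ i $ j"] by simp
  next
    case False
    \<comment> \<open>The reverse inequality is \<open>le\<close> applied to the scalar
      \<open>inverse c\<close> and the matrix already scaled by \<open>c\<close>.\<close>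
    have "?N A = ?N (\<chi> i j. inverse c * (\<chi> i j. c * A $ i $ j) $ i $ j)"
      using False by (simp add: mult.assoc[symmetric])
    also have "\<dots> \<le> norm (inverse c) * ?N (\<chi> i j. c * A $ i $ j)"
      by (rule le)
    finally have "norm c * ?N A \<le> ?N (\<chi> i j. c * A $ i $ j)"
      using False by (simp add: norm_inverse norm_divide field_simps)
    then show ?thesis using le[of c A] by simp
  qed
  show "?N (A ** B) \<le> ?N A * ?N B"
  proof (rule lp_operator_norm_least[OF p])
    fix v
    have "lp_norm p ((A ** B) *v v) \<le> ?N A * lp_norm p (B *v v)"
      unfolding matrix_vector_mul_assoc[symmetric] by (rule lp_operator_norm_apply[OF p])
    also have "\<dots> \<le> ?N A * (?N B * lp_norm p v)"
      by (intro mult_left_mono lp_operator_norm_apply lp_operator_norm_nonneg p)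
    finally show "lp_norm p ((A ** B) *v v) \<le> ?N A * ?N B * lp_norm p v" by (simp add: mult.assoc)
  qed
qed

lemma mat22_nth [simp]:
  "mat22 a b c d $ 1 $ 1 = a" "mat22 a b c d $ 1 $ 2 = b"
  "mat22 a b c d $ 2 $ 1 = c" "mat22 a b c d $ 2 $ 2 = d"
  by (simp_all add: mat22_def)

text \<open>The matrix only flips the sign of a coordinate, hence is an isometry for every
  p.\<close>

lemma lp_operator_norm_diag:
  assumes p: "1 \<le> p"
  shows "lp_operator_norm p (mat22 1 0 0 (-1) :: 'a::real_normed_field ^ 2 ^ 2) = 1"
proof -
  let ?D = "mat22 1 0 0 (-1) :: 'a ^ 2 ^ 2"
  have eq: "lp_norm p (?D *v v) = lp_norm p v" for v :: "'a ^ 2"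
  proof (rule lp_norm_cong)
    show "norm ((?D *v v) $ i) = norm (v $ i)" for i
      using exhaust_2[of i] by (auto simp: matrix_vector_mult_def sum_2)
  qed
  have "lp_operator_norm p ?D \<le> 1"
    by (rule lp_operator_norm_least[OF p]) (simp add: eq)
  moreover have "lp_norm p (axis 1 1 :: 'a ^ 2) \<le> lp_operator_norm p ?D * lp_norm p (axis 1 1 :: 'a ^ 2)"
    using lp_operator_norm_apply[OF p, of ?D "axis 1 1"] by (simp add: eq)
  then have "1 \<le> lp_operator_norm p ?D"
    using lp_norm_pos[OF p, of "axis 1 1 :: 'a ^ 2"] by (simp add: axis_eq_0_iff)
  ultimately show ?thesis by simp
qed


section \<open>The Magnus weight as a Beta integral\<close>

abbreviation I2 :: "real measure" where
  "I2 \<equiv> restrict_space lborel {0..<2}"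

abbreviation I2pow :: "nat \<Rightarrow> (nat \<Rightarrow> real) measure" where
  "I2pow k \<equiv> \<Pi>\<^sub>M i\<in>{..<k}. I2"

abbreviation I1 :: "real measure" where
  "I1 \<equiv> restrict_space lborel {0..1}"

lemma space_I2 [simp]: "space I2 = {0..<2}"
  by simp

lemma space_I1 [simp]: "space I1 = {0..1}"
  by simp

lemma finite_measure_I2: "finite_measure I2"
  by (rule finite_measureI) (simp add: emeasure_restrict_space)

lemma finite_measure_I1: "finite_measure I1"
  by (rule finite_measureI) (simp add: emeasure_restrict_space)

lemma product_sigma_finite_I2: "product_sigma_finite (\<lambda>_::nat. I2)"
  unfolding product_sigma_finite_def
  using finite_measure_I2 finite_measure.axioms(1) by blast

lemma emeasure_space_I2pow: "emeasure (I2pow k) (space (I2pow k)) = 2 ^ k"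
proof -
  interpret product_sigma_finite "\<lambda>_::nat. I2" by (rule product_sigma_finite_I2)
  have "emeasure I2 {0..<2} = 2"
    by (subst emeasure_restrict_space) auto
  moreover have "{0..<2} \<in> sets I2"
    using sets.top[of I2] by (simp only: space_I2)
  ultimately show ?thesis
    by (simp add: space_PiM emeasure_PiM)
qed

lemma measure_space_I2pow: "measure (I2pow k) (space (I2pow k)) = 2 ^ k"
  by (simp add: measure_def emeasure_space_I2pow ennreal_power[symmetric] flip: ennreal_numeral)

lemma finite_measure_I2pow: "finite_measure (I2pow k)"
  by (rule finite_measureI) (simp add: emeasure_space_I2pow power_eq_top_ennreal)

lemma borel_measurable_I2: "f \<in> borel_measurable borel \<Longrightarrow> f \<in> borel_measurable I2"
  by (rule measurable_restrict_space1) simp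

lemma borel_measurable_I1: "f \<in> borel_measurable borel \<Longrightarrow> f \<in> borel_measurable I1"
  by (rule measurable_restrict_space1) simp

lemma component_borel_measurable:
  assumes "i < k"
  shows "(\<lambda>t. t i) \<in> borel_measurable (I2pow k)"
proof -
  have "(\<lambda>t. t i) \<in> measurable (I2pow k) I2"
    using assms by (intro measurable_component_singleton) simp
  moreover have "(\<lambda>x. x) \<in> measurable I2 borel" by (rule borel_measurable_I2) simp
  ultimately show ?thesis by (rule measurable_compose)
qed

text \<open>This is where the atomlessness of the measure enters: with all coordinates but
  \<open>Suc i\<close> fixed, the slice of the set of ties is contained in the single point
  \<open>x i\<close>.\<close>

lemma AE_I2pow_neq:
  assumes "Suc i < k"
  shows "AE t in I2pow k. t i \<noteq> t (Suc i)"
proof -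
  interpret product_sigma_finite "\<lambda>_::nat. I2" by (rule product_sigma_finite_I2)
  let ?J = "{..<k} - {Suc i}"
  have J: "{..<k} = insert (Suc i) ?J" using assms by auto
  define S where "S = {t \<in> space (I2pow k). t i = t (Suc i)}"
  have m: "(\<lambda>t. t i) \<in> borel_measurable (I2pow k)"
    "(\<lambda>t. t (Suc i)) \<in> borel_measurable (I2pow k)"
    using assms by (auto intro!: component_borel_measurable)
  have S: "S \<in> sets (I2pow k)" unfolding S_def by (rule borel_measurable_eq[OF m])
  have "emeasure (I2pow k) S = (\<integral>\<^sup>+ t. indicator S t \<partial>I2pow k)"
    using S by simp
  also have "\<dots> = (\<integral>\<^sup>+ x. (\<integral>\<^sup>+ y. indicator S (x(Suc i := y)) \<partial>I2) \<partial>PiM ?J (\<lambda>_. I2))"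
  proof -
    have "S \<in> sets (PiM (insert (Suc i) ?J) (\<lambda>_. I2))"
      using S by (simp only: J[symmetric])
    then have "(\<integral>\<^sup>+ t. indicator S t \<partial>PiM (insert (Suc i) ?J) (\<lambda>_. I2)) =
       (\<integral>\<^sup>+ x. (\<integral>\<^sup>+ y. indicator S (x(Suc i := y)) \<partial>I2) \<partial>PiM ?J (\<lambda>_. I2))"
      by (intro product_nn_integral_insert) auto
    then show ?thesis by (simp only: J[symmetric])
  qed
  also have "\<dots> \<le> (\<integral>\<^sup>+ x. (\<integral>\<^sup>+ y. indicator {x i} y \<partial>lborel) \<partial>PiM ?J (\<lambda>_. I2))"
  proof (rule nn_integral_mono)
    fix x
    have "(\<integral>\<^sup>+ y. indicator S (x(Suc i := y)) \<partial>I2) \<le> (\<integral>\<^sup>+ y. indicator {x i} y \<partial>I2)"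
      by (rule nn_integral_mono) (auto simp: S_def indicator_def)
    also have "\<dots> \<le> (\<integral>\<^sup>+ y. indicator {x i} y \<partial>lborel)"
      by (subst nn_integral_restrict_space, simp, rule nn_integral_mono) (simp split: split_indicator)
    finally show "(\<integral>\<^sup>+ y. indicator S (x(Suc i := y)) \<partial>I2) \<le> (\<integral>\<^sup>+ y. indicator {x i} y \<partial>lborel)" .
  qed
  also have "\<dots> = 0" by simp
  finally have "emeasure (I2pow k) S = 0" by simp
  then show ?thesis
    using S by (intro AE_I[of _ _ S]) (auto simp: S_def)
qed

text \<open>The value at ties \<open>s = y\<close> is irrelevant: they form a null set.\<close>

definition jump :: "real \<Rightarrow> real \<Rightarrow> real \<Rightarrow> real" where
  "jump x s y = (if s < y then x else x - 1)"

definition jump_prod :: "real \<Rightarrow> nat \<Rightarrow> (nat \<Rightarrow> real) \<Rightarrow> real" where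
  "jump_prod x k t = (\<Prod>i<k - 1. jump x (t i) (t (Suc i)))"

lemma jump_measurable [measurable]:
  assumes "f \<in> borel_measurable M" "g \<in> borel_measurable M" "h \<in> borel_measurable M"
  shows "(\<lambda>w. jump (f w) (g w) (h w)) \<in> borel_measurable M"
proof -
  note assms [measurable]
  show ?thesis unfolding jump_def by measurable
qed

lemma jump_prod_measurable:
  assumes "f \<in> borel_measurable M" "\<And>i. i < k \<Longrightarrow> (\<lambda>w. g w i) \<in> borel_measurable M"
  shows "(\<lambda>w. jump_prod (f w) k (g w)) \<in> borel_measurable M"
  unfolding jump_prod_def
  by (rule borel_measurable_prod, rule jump_measurable) (use assms in auto)

lemma abs_jump_le_1: "x \<in> {0..1} \<Longrightarrow> \<bar>jump x s y\<bar> \<le> 1"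
  by (auto simp: jump_def)

lemma abs_jump_prod_le_1:
  assumes "x \<in> {0..1}"
  shows "\<bar>jump_prod x k t\<bar> \<le> 1"
  unfolding jump_prod_def abs_prod
  by (rule prod_le_1) (use abs_jump_le_1[OF assms] in auto)

lemma jump_prod_Suc_Suc: "jump_prod x (Suc (Suc k)) t = jump_prod x (Suc k) t * jump x (t k) (t (Suc k))"
  by (simp add: jump_prod_def)

text \<open>The induction on \<open>b\<close> rests on (1 - x)^(b+1) = (1 - x)^b - x (1 - x)^b,
  which raises \<open>a\<close> in the second term; hence \<open>a\<close> is kept
  arbitrary.\<close>

lemma Beta_integral_nat:
  "((\<lambda>x::real. x ^ a * (1 - x) ^ b) has_integral (fact a * fact b / fact (Suc (a + b)))) {0..1}"
proof (induction b arbitrary: a)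
  case 0
  have "((\<lambda>x::real. x ^ a) has_integral (1 ^ Suc a / real (Suc a) - 0 ^ Suc a / real (Suc a))) {0..1}"
  proof (rule fundamental_theorem_of_calculus)
    fix x :: real
    have "((\<lambda>x. x ^ Suc a / real (Suc a)) has_field_derivative x ^ a) (at x within {0..1})"
      by (rule derivative_eq_intros refl | simp del: of_nat_Suc)+
    then show "((\<lambda>x. x ^ Suc a / real (Suc a)) has_vector_derivative x ^ a) (at x within {0..1})"
      by (simp add: has_real_derivative_iff_has_vector_derivative)
  qed simp
  moreover have "fact a * fact 0 / fact (Suc (a + 0)) = (1 ^ Suc a / real (Suc a) - 0 ^ Suc a / real (Suc a))"
    by (simp add: divide_simps)
  ultimately show ?case by simp
next
  case (Suc b)
  have 1: "((\<lambda>x::real. (x ^ a * (1 - x) ^ b) - x ^ Suc a * (1 - x) ^ b) has_integral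
     (fact a * fact b / fact (Suc (a + b)) - fact (Suc a) * fact b / fact (Suc (Suc a + b)))) {0..1}"
    by (rule has_integral_diff[OF Suc Suc])
  have "(fact a * fact b / fact (Suc (a + b)) - fact (Suc a) * fact b / fact (Suc (Suc a + b)) :: real)
      = fact a * fact (Suc b) / fact (Suc (a + Suc b))"
    by (simp add: divide_simps del: fact_Suc of_nat_Suc)
       (simp add: algebra_simps)
  with 1 show ?case by (simp add: algebra_simps)
qed

text \<open>A tie would contribute a factor x - 1 to the product while being neither an ascent nor a
  descent. Without ties the non-ascents are exactly the descents, and the k - 1 consecutive pairs
  split into the two kinds.\<close>

lemma jump_prod_eq_powers:
  assumes "\<And>i. Suc i < k \<Longrightarrow> t i \<noteq> t (Suc i)"
  shows "jump_prod x k t = x ^ asc k t * (x - 1) ^ des k t" and "0 < k \<Longrightarrow> Suc (asc k t + des k t) = k"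
proof -
  let ?I = "{..<k - 1}"
  have a: "{i. Suc i < k \<and> t i < t (Suc i)} = {i \<in> ?I. t i < t (Suc i)}" by auto
  have d: "{i. Suc i < k \<and> t i > t (Suc i)} = {i \<in> ?I. \<not> t i < t (Suc i)}" 
    using assms by (force simp: not_less less_le)
  have "jump_prod x k t = (\<Prod>i\<in>{i \<in> ?I. t i < t (Suc i)}. x) * (\<Prod>i\<in>{i \<in> ?I. \<not> t i < t (Suc i)}. (x - 1))"
    unfolding jump_prod_def jump_def by (simp add: prod.If_cases Int_def)
  then show "jump_prod x k t = x ^ asc k t * (x - 1) ^ des k t"
    by (simp add: asc_def des_def a d)
  have "asc k t + des k t = card ({i \<in> ?I. t i < t (Suc i)} \<union> {i \<in> ?I. \<not> t i < t (Suc i)})"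
    unfolding asc_def des_def a d by (rule card_Un_disjoint[symmetric]) auto
  also have "{i \<in> ?I. t i < t (Suc i)} \<union> {i \<in> ?I. \<not> t i < t (Suc i)} = ?I" by auto
  finally show "0 < k \<Longrightarrow> Suc (asc k t + des k t) = k" by simp
qed

text \<open>The sign of the Magnus weight comes from (x - 1)^d = (-1)^d (1 - x)^d, and the
  denominator \<open>fact k\<close> from ascents plus descents being k - 1.\<close>

lemma integral_jump_prod:
  assumes "0 < k" "\<And>i. Suc i < k \<Longrightarrow> t i \<noteq> t (Suc i)"
  shows "(\<integral>x. jump_prod x k t \<partial>I1) = (-1) ^ des k t * (fact (asc k t) * fact (des k t) / fact k)"
proof -
  let ?a = "asc k t" and ?d = "des k t"
  have eq: "jump_prod x k t = (-1) ^ ?d * (x ^ ?a * (1 - x) ^ ?d)" for x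
  proof -
    have "(x - 1) ^ ?d = (-1) ^ ?d * (1 - x) ^ ?d" 
      by (metis minus_diff_eq power_minus)
    then show ?thesis using jump_prod_eq_powers(1)[of k t, OF assms(2)] by simp
  qed
  have "(\<integral>x. x ^ ?a * (1 - x) ^ ?d \<partial>I1) = (LINT x:{0..1}|lborel. x ^ ?a * (1 - x) ^ ?d)"
    by (simp add: integral_restrict_space set_lebesgue_integral_def)
  also have "\<dots> = integral {0..1} (\<lambda>x. x ^ ?a * (1 - x) ^ ?d)"
    by (rule set_borel_integral_eq_integral) 
       (intro borel_integrable_atLeastAtMost' continuous_intros)
  also have "\<dots> = fact ?a * fact ?d / fact (Suc (?a + ?d))"
    by (rule integral_unique, rule Beta_integral_nat)
  finally show ?thesis
    using jump_prod_eq_powers(2)[of k t, OF assms(2) assms(1)] by (simp add: eq)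
qed


section \<open>Iterated integrals with a jump kernel\<close>

text \<open>The densities act on an abstract Euclidean space because two instances are used: left
  multiplication on matrices, which yields integrability of the matrix integrand, and the action on
  \<open>real \<times> real\<close>, where the integral equation is solved explicitly.\<close>

locale bounded_linear_pair =
  fixes F G :: "'b::euclidean_space \<Rightarrow> 'b" and C :: real
  assumes linear_F: "bounded_linear F" and linear_G: "bounded_linear G"
    and bound_F: "norm (F w) \<le> C * norm w" and bound_G: "norm (G w) \<le> C * norm w"
    and C_nonneg: "0 \<le> C"
begin

definition dens :: "real \<Rightarrow> 'b \<Rightarrow> 'b" where
  "dens s w = (if s < 1 then F w else G w)"

definition word :: "nat \<Rightarrow> (nat \<Rightarrow> real) \<Rightarrow> 'b \<Rightarrow> 'b" where
  "word k t w = foldr (\<lambda>i. dens (t i)) [0..<k] w"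

text \<open>\<open>iter x k \<phi>\<close> integrates over \<open>k + 1\<close> variables; it is the \<open>x\<close>-part of the Magnus term of index \<open>k + 1\<close>.\<close>

definition trans :: "real \<Rightarrow> (real \<Rightarrow> 'b) \<Rightarrow> real \<Rightarrow> 'b" where
  "trans x \<phi> s = (\<integral>y. jump x s y *\<^sub>R dens y (\<phi> y) \<partial>I2)"

definition iter :: "real \<Rightarrow> nat \<Rightarrow> (real \<Rightarrow> 'b) \<Rightarrow> 'b" where
  "iter x k \<phi> = (\<integral>t. jump_prod x (Suc k) t *\<^sub>R word (Suc k) t (\<phi> (t k)) \<partial>I2pow (Suc k))"

lemma linear_dens: "bounded_linear (dens s)"
  using linear_F linear_G by (cases "s < 1") (simp_all add: dens_def[abs_def])

lemma norm_dens_le: "norm (dens s w) \<le> C * norm w"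
  by (simp add: dens_def bound_F bound_G)

lemma dens_measurable [measurable]:
  assumes [measurable]: "f \<in> borel_measurable M" "g \<in> borel_measurable M"
  shows "(\<lambda>w. dens (f w) (g w)) \<in> borel_measurable M"
proof -
  have "F \<in> borel_measurable borel" "G \<in> borel_measurable borel"
    using linear_F linear_G by (auto intro!: borel_measurable_continuous_onI linear_continuous_on)
  then have "(\<lambda>w. F (g w)) \<in> borel_measurable M" "(\<lambda>w. G (g w)) \<in> borel_measurable M"
    using assms(2) by (auto intro: measurable_compose)
  note this [measurable]
  show ?thesis unfolding dens_def by measurable
qed

lemma word_0 [simp]: "word 0 t w = w"
  by (simp add: word_def)

lemma word_Suc: "word (Suc k) t w = word k t (dens (t k) w)"
  by (simp add: word_def)

lemma linear_word: "bounded_linear (word k t)"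
proof (induction k)
  case 0
  then show ?case by (simp add: word_def bounded_linear_ident)
next
  case (Suc k)
  then show ?case
    using bounded_linear_compose[OF Suc linear_dens] by (simp add: word_Suc)
qed

lemma norm_word_le: "norm (word k t w) \<le> C ^ k * norm w"
proof (induction k arbitrary: w)
  case 0
  then show ?case by simp
next
  case (Suc k)
  have "norm (word (Suc k) t w) \<le> C ^ k * norm (dens (t k) w)"
    using Suc by (simp add: word_Suc)
  also have "\<dots> \<le> C ^ k * (C * norm w)"
    using norm_dens_le C_nonneg by (intro mult_left_mono) auto
  finally show ?case by (simp add: algebra_simps)
qed

lemma word_measurable:
  assumes "\<And>i. i < k \<Longrightarrow> (\<lambda>w. t w i) \<in> borel_measurable M" "g \<in> borel_measurable M"
  shows "(\<lambda>w. word k (t w) (g w)) \<in> borel_measurable M"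
  using assms
proof (induction k arbitrary: g)
  case 0
  then show ?case by simp
next
  case (Suc k)
  have "(\<lambda>w. dens (t w k) (g w)) \<in> borel_measurable M"
    by (rule dens_measurable) (use Suc.prems in auto)
  then show ?case
    using Suc.prems(1) unfolding word_Suc by (intro Suc.IH) auto
qed

lemma word_cong: "(\<And>i. i < k \<Longrightarrow> t i = t' i) \<Longrightarrow> word k t w = word k t' w"
  unfolding word_def by (rule foldr_cong) auto

lemma iter_integrand_measurable:
  assumes "\<phi> \<in> borel_measurable borel"
  shows "(\<lambda>t. jump_prod x (Suc k) t *\<^sub>R word (Suc k) t (\<phi> (t k))) \<in> borel_measurable (I2pow (Suc k))"
proof (rule borel_measurable_scaleR)
  show "jump_prod x (Suc k) \<in> borel_measurable (I2pow (Suc k))"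
    by (rule jump_prod_measurable) (auto intro: component_borel_measurable)
  have "(\<lambda>t. \<phi> (t k)) \<in> borel_measurable (I2pow (Suc k))"
    by (rule measurable_compose[OF component_borel_measurable assms]) simp
  then show "(\<lambda>t. word (Suc k) t (\<phi> (t k))) \<in> borel_measurable (I2pow (Suc k))"
    by (intro word_measurable) (auto intro: component_borel_measurable)
qed

lemma space_I2pow_component: "t \<in> space (I2pow k) \<Longrightarrow> i < k \<Longrightarrow> t i \<in> {0..<2}"
  by (auto simp: space_PiM PiE_def Pi_def)

lemma norm_iter_integrand_le:
  assumes "x \<in> {0..1}" "\<And>s. s \<in> {0..<2} \<Longrightarrow> norm (\<phi> s) \<le> B" "t \<in> space (I2pow (Suc k))"
  shows "norm (jump_prod x (Suc k) t *\<^sub>R word (Suc k) t (\<phi> (t k))) \<le> C ^ Suc k * B"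
proof -
  have "norm (jump_prod x (Suc k) t *\<^sub>R word (Suc k) t (\<phi> (t k)))
      \<le> 1 * (C ^ Suc k * norm (\<phi> (t k)))"
    unfolding norm_scaleR
    by (rule mult_mono) (use abs_jump_prod_le_1[OF assms(1)] norm_word_le C_nonneg in \<open>auto simp del: power_Suc\<close>)
  also have "\<dots> \<le> 1 * (C ^ Suc k * B)"
    using assms C_nonneg space_I2pow_component[OF assms(3)] by (intro mult_left_mono) auto
  finally show ?thesis by simp
qed

lemma iter_integrable:
  assumes "x \<in> {0..1}" "\<phi> \<in> borel_measurable borel" "\<And>s. s \<in> {0..<2} \<Longrightarrow> norm (\<phi> s) \<le> B"
  shows "integrable (I2pow (Suc k)) (\<lambda>t. jump_prod x (Suc k) t *\<^sub>R word (Suc k) t (\<phi> (t k)))"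
proof (rule finite_measure.integrable_const_bound[OF finite_measure_I2pow])
  show "AE t in I2pow (Suc k). norm (jump_prod x (Suc k) t *\<^sub>R word (Suc k) t (\<phi> (t k))) \<le> C ^ Suc k * B"
    by (intro AE_I2 norm_iter_integrand_le[OF assms(1), of \<phi> B, OF assms(3)])
qed (rule iter_integrand_measurable[OF assms(2)])

text \<open>The cube has volume 2^(k+1) and the jump product has modulus at most 1. The growth rate
  2C is the source of the condition \<open>\<bar>z\<bar> * (2 * C) < 1\<close> on the generating
  functions.\<close>

lemma norm_iter_le:
  assumes "x \<in> {0..1}" "\<phi> \<in> borel_measurable borel" "\<And>s. s \<in> {0..<2} \<Longrightarrow> norm (\<phi> s) \<le> B"
  shows "norm (iter x k \<phi>) \<le> (2 * C) ^ Suc k * B"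
proof -
  have "norm (iter x k \<phi>) \<le> (\<integral>t. norm (jump_prod x (Suc k) t *\<^sub>R word (Suc k) t (\<phi> (t k))) \<partial>I2pow (Suc k))"
    unfolding iter_def by (rule integral_norm_bound)
  also have "\<dots> \<le> (\<integral>t. C ^ Suc k * B \<partial>I2pow (Suc k))"
    by (rule integral_mono)
       (intro integrable_norm iter_integrable[OF assms] finite_measure.integrable_const[OF finite_measure_I2pow]
         norm_iter_integrand_le[OF assms(1), of \<phi> B, OF assms(3)] | assumption)+
  also have "\<dots> = (2 * C) ^ Suc k * B"
    using measure_space_I2pow[of "Suc k"] by (simp add: power_mult_distrib)
  finally show ?thesis .
qed

lemma dens_integrable:
  assumes "x \<in> {0..1}" "\<phi> \<in> borel_measurable borel" "\<And>s. s \<in> {0..<2} \<Longrightarrow> norm (\<phi> s) \<le> B"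
  shows "integrable I2 (\<lambda>y. jump x s y *\<^sub>R dens y (\<phi> y))" "integrable I2 (\<lambda>y. dens y (\<phi> y))"
proof -
  have b: "norm (dens y (\<phi> y)) \<le> C * B" if "y \<in> {0..<2}" for y
    using norm_dens_le[of y "\<phi> y"] mult_left_mono[OF assms(3)[OF that] C_nonneg] by linarith
  show "integrable I2 (\<lambda>y. dens y (\<phi> y))"
    by (rule finite_measure.integrable_const_bound[OF finite_measure_I2, of _ "C * B"])
       (use b in \<open>auto intro!: AE_I2 borel_measurable_I2 dens_measurable assms\<close>)
  have "norm (jump x s y *\<^sub>R dens y (\<phi> y)) \<le> 1 * (C * B)" if "y \<in> {0..<2}" for y
    unfolding norm_scaleR
    by (rule mult_mono) (use abs_jump_le_1[OF assms(1)] b that in auto)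
  then show "integrable I2 (\<lambda>y. jump x s y *\<^sub>R dens y (\<phi> y))"
    by (intro finite_measure.integrable_const_bound[OF finite_measure_I2, of _ "C * B"])
       (auto intro!: AE_I2 borel_measurable_I2 dens_measurable borel_measurable_scaleR jump_measurable assms)
qed

text \<open>By Fubini the last variable is integrated first. It occurs only in the last jump factor
  and in the innermost factor of the word; the rest of the word is bounded linear and moves out of
  the inner integral, which becomes \<open>trans x \<phi>\<close> at the preceding variable.\<close>

lemma iter_Suc:
  assumes "x \<in> {0..1}" "\<phi> \<in> borel_measurable borel" "\<And>s. s \<in> {0..<2} \<Longrightarrow> norm (\<phi> s) \<le> B"
  shows "iter x (Suc k) \<phi> = iter x k (trans x \<phi>)"
proof -
  interpret product_sigma_finite "\<lambda>_::nat. I2" by (rule product_sigma_finite_I2)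
  let ?n = "Suc k"
  let ?f = "\<lambda>t. jump_prod x (Suc ?n) t *\<^sub>R word (Suc ?n) t (\<phi> (t ?n))"
  have I: "integrable (PiM (insert ?n {..<?n}) (\<lambda>_. I2)) ?f"
    using iter_integrable[OF assms, of ?n] by (simp add: lessThan_Suc)
  have "iter x (Suc k) \<phi> = (\<integral>t. (\<integral>y. ?f (t(?n := y)) \<partial>I2) \<partial>I2pow ?n)"
    unfolding iter_def lessThan_Suc[of ?n]
    by (rule product_integral_insert[OF _ _ I]) auto
  also have "\<dots> = (\<integral>t. jump_prod x (Suc k) t *\<^sub>R word (Suc k) t (trans x \<phi> (t k)) \<partial>I2pow ?n)"
  proof (rule Bochner_Integration.integral_cong[OF refl])
    fix t
    have "?f (t(?n := y)) = jump_prod x ?n t *\<^sub>R word ?n t (jump x (t k) y *\<^sub>R dens y (\<phi> y))" for y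
    proof -
      have "word ?n (t(?n := y)) w = word ?n t w" for w
        by (rule word_cong) auto
      moreover have "jump_prod x ?n (t(?n := y)) = jump_prod x ?n t"
        by (auto simp: jump_prod_def)
      ultimately show ?thesis
        unfolding jump_prod_Suc_Suc word_Suc[of ?n]
        by (simp add: linear_simps(5)[OF linear_word])
    qed
    then have "(\<integral>y. ?f (t(?n := y)) \<partial>I2)
        = jump_prod x ?n t *\<^sub>R (\<integral>y. word ?n t (jump x (t k) y *\<^sub>R dens y (\<phi> y)) \<partial>I2)"
      by simp
    also have "(\<integral>y. word ?n t (jump x (t k) y *\<^sub>R dens y (\<phi> y)) \<partial>I2) = word ?n t (trans x \<phi> (t k))"
      unfolding trans_def
      by (rule integral_bounded_linear[OF linear_word dens_integrable(1)[OF assms]])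
    finally show "(\<integral>y. ?f (t(?n := y)) \<partial>I2) = jump_prod x ?n t *\<^sub>R word ?n t (trans x \<phi> (t k))" .
  qed
  finally show ?thesis unfolding iter_def .
qed

lemma iter_0:
  assumes "\<phi> \<in> borel_measurable borel"
  shows "iter x 0 \<phi> = (\<integral>y. dens y (\<phi> y) \<partial>I2)"
proof -
  interpret product_sigma_finite "\<lambda>_::nat. I2" by (rule product_sigma_finite_I2)
  have "{..<Suc 0} = {0}" by auto
  then show ?thesis
    using product_integral_singleton[of "\<lambda>y. dens y (\<phi> y)" 0] assms
    by (simp add: iter_def jump_prod_def word_Suc borel_measurable_I2 dens_measurable)
qed

lemma trans_measurable:
  assumes "\<phi> \<in> borel_measurable borel"
  shows "trans x \<phi> \<in> borel_measurable borel"
proof -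
  interpret sigma_finite_measure I2 using finite_measure_I2 finite_measure.axioms(1) by blast
  have [measurable]: "(\<lambda>x. x) \<in> borel_measurable I2" by (rule borel_measurable_I2) simp
  have s: "snd \<in> borel_measurable (borel \<Otimes>\<^sub>M I2)"
    by (rule measurable_compose[OF measurable_snd]) measurable
  have "(\<lambda>(s, y). jump x s y *\<^sub>R dens y (\<phi> y)) \<in> borel_measurable (borel \<Otimes>\<^sub>M I2)"
    unfolding case_prod_beta
    by (intro borel_measurable_scaleR jump_measurable dens_measurable measurable_compose[OF s assms] s)
       (auto intro: measurable_fst)
  then show ?thesis
    unfolding trans_def[abs_def] by (rule borel_measurable_lebesgue_integral)
qed

lemma iter_cong:
  assumes "\<And>s. s \<in> {0..<2} \<Longrightarrow> \<phi> s = \<psi> s"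
  shows "iter x k \<phi> = iter x k \<psi>"
  unfolding iter_def
  by (rule Bochner_Integration.integral_cong[OF refl])
     (use assms space_I2pow_component in \<open>metis lessI\<close>)

lemma norm_trans_le:
  assumes "x \<in> {0..1}" "\<phi> \<in> borel_measurable borel" "\<And>s. s \<in> {0..<2} \<Longrightarrow> norm (\<phi> s) \<le> B"
  shows "norm (trans x \<phi> s) \<le> 2 * (C * B)"
proof -
  have "norm (\<phi> 0) \<le> B" by (rule assms(3)) simp
  then have "0 \<le> B" using norm_ge_zero[of "\<phi> 0"] by linarith
  have b: "norm (jump x s y *\<^sub>R dens y (\<phi> y)) \<le> 1 * (C * B)" if "y \<in> {0..<2}" for y
    unfolding norm_scaleR
    using norm_dens_le[of y "\<phi> y"] mult_left_mono[OF assms(3)[OF that] C_nonneg]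
    by (intro mult_mono) (use abs_jump_le_1[OF assms(1)] in \<open>auto intro: order_trans\<close>)
  have "norm (trans x \<phi> s) \<le> (\<integral>y. norm (jump x s y *\<^sub>R dens y (\<phi> y)) \<partial>I2)"
    unfolding trans_def by (rule integral_norm_bound)
  also have "\<dots> \<le> (\<integral>y. C * B \<partial>I2)"
    by (rule integral_mono)
       (use b in \<open>auto intro!: integrable_norm dens_integrable(1)[OF assms] finite_measure.integrable_const[OF finite_measure_I2]
          simp del: norm_scaleR\<close>)
  also have "\<dots> = 2 * (C * B)"
    by (simp add: measure_restrict_space)
  finally show ?thesis .
qed

text \<open>Substituting the equation for \<open>\<Phi>\<close> into \<open>iter x k \<Phi>\<close> makes the partial sums telescope.\<close>

lemma iter_sums:
  assumes x: "x \<in> {0..1}" and \<Phi>: "\<Phi> \<in> borel_measurable borel"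
    and B: "\<And>s. s \<in> {0..<2} \<Longrightarrow> norm (\<Phi> s) \<le> B"
    and eq: "\<And>s. s \<in> {0..<2} \<Longrightarrow> \<Phi> s = v + z *\<^sub>R trans x \<Phi> s"
    and z: "\<bar>z\<bar> * (2 * C) < 1"
  shows "(\<lambda>k. z ^ k *\<^sub>R iter x k (\<lambda>_. v)) sums (\<integral>y. dens y (\<Phi> y) \<partial>I2)"
proof -
  have step: "iter x k \<Phi> = iter x k (\<lambda>_. v) + z *\<^sub>R iter x (Suc k) \<Phi>" for k
  proof -
    have "iter x k \<Phi> = iter x k (\<lambda>s. v + z *\<^sub>R trans x \<Phi> s)"
      by (rule iter_cong[OF eq])
    also have "\<dots> = (\<integral>t. jump_prod x (Suc k) t *\<^sub>R word (Suc k) t v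
        + z *\<^sub>R (jump_prod x (Suc k) t *\<^sub>R word (Suc k) t (trans x \<Phi> (t k))) \<partial>I2pow (Suc k))"
      unfolding iter_def
      by (simp add: linear_simps(1,5)[OF linear_word] scaleR_add_right mult.commute)
    also have "\<dots> = iter x k (\<lambda>_. v) + z *\<^sub>R iter x k (trans x \<Phi>)"
    proof -
      have "integrable (I2pow (Suc k)) (\<lambda>t. jump_prod x (Suc k) t *\<^sub>R word (Suc k) t v)"
        using iter_integrable[OF x, of "\<lambda>_. v" "norm v" k] by simp
      moreover have "integrable (I2pow (Suc k)) (\<lambda>t. jump_prod x (Suc k) t *\<^sub>R word (Suc k) t (trans x \<Phi> (t k)))"
        by (rule iter_integrable[OF x trans_measurable[OF \<Phi>] norm_trans_le[OF x \<Phi> B]])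
      ultimately show ?thesis
        unfolding iter_def by (simp del: scaleR_scaleR)
    qed
    also have "iter x k (trans x \<Phi>) = iter x (Suc k) \<Phi>"
      by (rule iter_Suc[OF x \<Phi> B, symmetric])
    finally show ?thesis .
  qed
  have partial: "(\<Sum>k<n. z ^ k *\<^sub>R iter x k (\<lambda>_. v)) = iter x 0 \<Phi> - z ^ n *\<^sub>R iter x n \<Phi>" for n
  proof (induction n)
    case (Suc n)
    have "z ^ n *\<^sub>R iter x n \<Phi> = z ^ n *\<^sub>R iter x n (\<lambda>_. v) + z ^ Suc n *\<^sub>R iter x (Suc n) \<Phi>"
      by (subst step[of n]) (simp add: scaleR_add_right mult.commute)
    with Suc show ?case by simp
  qed simp
  \<comment> \<open>The remainder of the telescoping sum decays geometrically with ratio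
    \<open>\<bar>z\<bar> * (2 * C)\<close>.\<close>
  have "(\<lambda>n. z ^ n *\<^sub>R iter x n \<Phi>) \<longlonglongrightarrow> 0"
  proof (rule Lim_null_comparison)
    show "\<forall>\<^sub>F n in sequentially. norm (z ^ n *\<^sub>R iter x n \<Phi>) \<le> (\<bar>z\<bar> * (2 * C)) ^ n * (2 * C * B)"
    proof (rule always_eventually, rule allI)
      fix n
      have "norm (z ^ n *\<^sub>R iter x n \<Phi>) \<le> \<bar>z\<bar> ^ n * ((2 * C) ^ Suc n * B)"
        unfolding norm_scaleR power_abs
        by (rule mult_left_mono[OF norm_iter_le[OF x \<Phi> B]]) auto
      then show "norm (z ^ n *\<^sub>R iter x n \<Phi>) \<le> (\<bar>z\<bar> * (2 * C)) ^ n * (2 * C * B)"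
        by (simp add: power_mult_distrib mult_ac)
    qed
    have "(\<lambda>n. (\<bar>z\<bar> * (2 * C)) ^ n) \<longlonglongrightarrow> 0"
      by (rule LIMSEQ_realpow_zero) (use z C_nonneg in auto)
    then show "(\<lambda>n. (\<bar>z\<bar> * (2 * C)) ^ n * (2 * C * B)) \<longlonglongrightarrow> 0"
      by (rule tendsto_mult_left_zero)
  qed
  then have "(\<lambda>n. iter x 0 \<Phi> - z ^ n *\<^sub>R iter x n \<Phi>) \<longlonglongrightarrow> iter x 0 \<Phi> - 0"
    by (intro tendsto_intros)
  then show ?thesis
    unfolding sums_def partial by (simp add: iter_0[OF \<Phi>])
qed


section \<open>Exchanging the average over x with the Magnus integral and with the power
  series\<close>

lemma asc_measurable: "asc k \<in> measurable (I2pow k) (count_space UNIV)"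
  and des_measurable: "des k \<in> measurable (I2pow k) (count_space UNIV)"
proof -
  have "{t \<in> space (I2pow k). i \<in> {i. Suc i < k \<and> t i < t (Suc i)}} \<in> sets (I2pow k)" for i
    by (cases "Suc i < k") (auto intro!: borel_measurable_less component_borel_measurable)
  then show "asc k \<in> measurable (I2pow k) (count_space UNIV)"
    unfolding asc_def[abs_def] by (rule measurable_card)
  have "{t \<in> space (I2pow k). i \<in> {i. Suc i < k \<and> t i > t (Suc i)}} \<in> sets (I2pow k)" for i
    by (cases "Suc i < k") (auto intro!: borel_measurable_less component_borel_measurable)
  then show "des k \<in> measurable (I2pow k) (count_space UNIV)"
    unfolding des_def[abs_def] by (rule measurable_card)
qed

lemma jump_word_integrable:
  "integrable (I1 \<Otimes>\<^sub>M I2pow (Suc k)) (\<lambda>(x, t). jump_prod x (Suc k) t *\<^sub>R word (Suc k) t v)"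
proof (rule finite_measure.integrable_const_bound)
  show "finite_measure (I1 \<Otimes>\<^sub>M I2pow (Suc k))"
    by (rule finite_measure_pair_measure[OF finite_measure_I2pow finite_measure_I1])
  show "AE p in I1 \<Otimes>\<^sub>M I2pow (Suc k). norm (case p of (x, t) \<Rightarrow>
      jump_prod x (Suc k) t *\<^sub>R word (Suc k) t v) \<le> C ^ Suc k * norm v"
  proof (rule AE_I2)
    fix p assume "p \<in> space (I1 \<Otimes>\<^sub>M I2pow (Suc k))"
    then obtain x t where p: "p = (x, t)" "x \<in> {0..1}" "t \<in> space (I2pow (Suc k))"
      by (auto simp: space_pair_measure)
    then show "norm (case p of (x, t) \<Rightarrow> jump_prod x (Suc k) t *\<^sub>R word (Suc k) t v) \<le> C ^ Suc k * norm v"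
      using norm_iter_integrand_le[of x "\<lambda>_. v" "norm v" t k] by simp
  qed
  have f: "fst \<in> borel_measurable (I1 \<Otimes>\<^sub>M I2pow (Suc k))"
    by (rule measurable_compose[OF measurable_fst borel_measurable_I1]) simp
  have s: "(\<lambda>p. snd p i) \<in> borel_measurable (I1 \<Otimes>\<^sub>M I2pow (Suc k))" if "i < Suc k" for i
    by (rule measurable_compose[OF measurable_snd component_borel_measurable[OF that]])
  show "(\<lambda>(x, t). jump_prod x (Suc k) t *\<^sub>R word (Suc k) t v) \<in> borel_measurable (I1 \<Otimes>\<^sub>M I2pow (Suc k))"
    unfolding case_prod_beta
    by (intro borel_measurable_scaleR jump_prod_measurable word_measurable f s) auto
qed

lemma iter_measurable: "(\<lambda>x. iter x k (\<lambda>_. v)) \<in> borel_measurable I1"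
proof -
  interpret pair_sigma_finite I1 "I2pow (Suc k)"
    by (intro pair_sigma_finite.intro finite_measure.axioms(1) finite_measure_I1 finite_measure_I2pow)
  show ?thesis
    using integrable_fst[OF jump_word_integrable[of k v]] unfolding iter_def by simp
qed

text \<open>Since the word does not depend on x, integrating the jump product over x first yields
  the Magnus weight off the ties. Thus the weighted word is almost everywhere a partial integral of
  a jointly integrable function; this gives its integrability, and Fubini gives the value.\<close>

lemma
  shows weight_word_integrable: "integrable (I2pow (Suc k)) (\<lambda>t. ((-1) ^ des (Suc k) t *
      (fact (asc (Suc k) t) * fact (des (Suc k) t) / fact (Suc k))) *\<^sub>R word (Suc k) t v)" (is "integrable _ ?W")
    and integral_weight_word: "(\<integral>t. ((-1) ^ des (Suc k) t *
      (fact (asc (Suc k) t) * fact (des (Suc k) t) / fact (Suc k))) *\<^sub>R word (Suc k) t v \<partial>I2pow (Suc k))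
      = (\<integral>x. iter x k (\<lambda>_. v) \<partial>I1)"
proof -
  interpret pair_sigma_finite I1 "I2pow (Suc k)"
    by (intro pair_sigma_finite.intro finite_measure.axioms(1) finite_measure_I1 finite_measure_I2pow)
  let ?J = "\<lambda>t. \<integral>x. jump_prod x (Suc k) t *\<^sub>R word (Suc k) t v \<partial>I1"
  have J: "integrable (I2pow (Suc k)) ?J"
    by (rule integrable_snd[OF jump_word_integrable])
  have W: "?W \<in> borel_measurable (I2pow (Suc k))"
  proof (rule borel_measurable_scaleR)
    have "(\<lambda>t. (-1) ^ des (Suc k) t :: real) \<in> borel_measurable (I2pow (Suc k))"
      "(\<lambda>t. fact (des (Suc k) t) :: real) \<in> borel_measurable (I2pow (Suc k))"
      "(\<lambda>t. fact (asc (Suc k) t) :: real) \<in> borel_measurable (I2pow (Suc k))"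
      by (rule measurable_compose[OF des_measurable] measurable_compose[OF asc_measurable], simp)+
    then show "(\<lambda>t. (-1) ^ des (Suc k) t * (fact (asc (Suc k) t) * fact (des (Suc k) t) / fact (Suc k)) :: real)
        \<in> borel_measurable (I2pow (Suc k))"
      by (intro borel_measurable_times borel_measurable_divide) auto
    show "(\<lambda>t. word (Suc k) t v) \<in> borel_measurable (I2pow (Suc k))"
      by (intro word_measurable) (auto intro: component_borel_measurable)
  qed
  have "AE t in I2pow (Suc k). \<forall>i\<in>{i. Suc i < Suc k}. t i \<noteq> t (Suc i)"
    by (rule AE_ball_countable') (auto intro: AE_I2pow_neq)
  then have eq: "AE t in I2pow (Suc k). ?J t = ?W t"
  proof eventually_elim
    case (elim t)
    have "?J t = (\<integral>x. jump_prod x (Suc k) t \<partial>I1) *\<^sub>R word (Suc k) t v"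
    proof (rule integral_scaleR_left)
      assume "word (Suc k) t v \<noteq> 0"
      have "(\<lambda>x. jump_prod x (Suc k) t) \<in> borel_measurable I1"
        by (intro jump_prod_measurable borel_measurable_I1) auto
      then show "integrable I1 (\<lambda>x. jump_prod x (Suc k) t)"
        by (intro finite_measure.integrable_const_bound[OF finite_measure_I1, of _ 1])
           (auto intro!: AE_I2 abs_jump_prod_le_1)
    qed
    then show ?case
      using integral_jump_prod[of "Suc k" t] elim by simp
  qed
  show "integrable (I2pow (Suc k)) ?W"
    by (rule integrable_cong_AE_imp[OF J W]) (use eq in auto)
  have "integral\<^sup>L (I2pow (Suc k)) ?W = integral\<^sup>L (I2pow (Suc k)) ?J"
    by (rule integral_cong_AE[OF W borel_measurable_integrable[OF J]]) (use eq in auto)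
  also have "\<dots> = (\<integral>x. iter x k (\<lambda>_. v) \<partial>I1)"
    unfolding iter_def by (rule Fubini_integral[OF jump_word_integrable])
  finally show "integral\<^sup>L (I2pow (Suc k)) ?W = (\<integral>x. iter x k (\<lambda>_. v) \<partial>I1)" .
qed

text \<open>The geometric bound on the terms is uniform in x, so summation and integration over x
  may be interchanged. Integrability of \<open>R\<close> is inherited from the sum of the series,
  with which it agrees on [0, 1].\<close>

lemma integral_iter_sums:
  assumes sol: "\<And>x. x \<in> {0..1} \<Longrightarrow> (\<lambda>k. z ^ k *\<^sub>R iter x k (\<lambda>_. v)) sums R x"
    and z: "\<bar>z\<bar> * (2 * C) < 1"
  shows "(\<lambda>k. z ^ k *\<^sub>R (\<integral>x. iter x k (\<lambda>_. v) \<partial>I1)) sums (\<integral>x. R x \<partial>I1)"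
    and "integrable I1 R"
proof -
  have bound: "norm (z ^ k *\<^sub>R iter x k (\<lambda>_. v)) \<le> (\<bar>z\<bar> * (2 * C)) ^ k * (2 * C * norm v)"
    if "x \<in> {0..1}" for x k
  proof -
    have "norm (z ^ k *\<^sub>R iter x k (\<lambda>_. v)) \<le> \<bar>z\<bar> ^ k * ((2 * C) ^ Suc k * norm v)"
      unfolding norm_scaleR power_abs
      by (rule mult_left_mono[OF norm_iter_le[OF that]]) auto
    then show ?thesis by (simp add: power_mult_distrib mult_ac)
  qed
  have geo: "summable (\<lambda>k. (\<bar>z\<bar> * (2 * C)) ^ k * (2 * C * norm v))"
    by (rule summable_mult2, rule summable_geometric) (use z C_nonneg in simp)
  have meas: "(\<lambda>x. z ^ k *\<^sub>R iter x k (\<lambda>_. v)) \<in> borel_measurable I1" for k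
    by (intro borel_measurable_scaleR iter_measurable) auto
  have int: "integrable I1 (\<lambda>x. z ^ k *\<^sub>R iter x k (\<lambda>_. v))" for k
    by (rule finite_measure.integrable_const_bound[OF finite_measure_I1 _ meas,
        of _ "(\<bar>z\<bar> * (2 * C)) ^ k * (2 * C * norm v)"])
       (use bound in \<open>auto intro!: AE_I2 simp del: norm_scaleR\<close>)
  have AE_summable: "AE x in I1. summable (\<lambda>k. norm (z ^ k *\<^sub>R iter x k (\<lambda>_. v)))"
    by (rule AE_I2, rule summable_comparison_test'[OF geo]) (use bound in \<open>auto simp del: norm_scaleR\<close>)
  have summable_int: "summable (\<lambda>k. \<integral>x. norm (z ^ k *\<^sub>R iter x k (\<lambda>_. v)) \<partial>I1)"
  proof (rule summable_comparison_test'[OF geo])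
    fix k
    have "(\<integral>x. norm (z ^ k *\<^sub>R iter x k (\<lambda>_. v)) \<partial>I1) \<le> (\<integral>x. (\<bar>z\<bar> * (2 * C)) ^ k * (2 * C * norm v) \<partial>I1)"
      by (rule integral_mono)
         (use bound in \<open>auto intro!: integrable_norm int finite_measure.integrable_const[OF finite_measure_I1]
            simp del: norm_scaleR\<close>)
    then show "norm (\<integral>x. norm (z ^ k *\<^sub>R iter x k (\<lambda>_. v)) \<partial>I1) \<le> (\<bar>z\<bar> * (2 * C)) ^ k * (2 * C * norm v)"
      by (simp add: measure_restrict_space del: norm_scaleR)
  qed
  have R: "(\<Sum>k. z ^ k *\<^sub>R iter x k (\<lambda>_. v)) = R x" if "x \<in> space I1" for x
    using sol[of x] that by (simp add: sums_iff)
  show "(\<lambda>k. z ^ k *\<^sub>R (\<integral>x. iter x k (\<lambda>_. v) \<partial>I1)) sums (\<integral>x. R x \<partial>I1)"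
  proof -
    have "(\<integral>x. (\<Sum>k. z ^ k *\<^sub>R iter x k (\<lambda>_. v)) \<partial>I1) = (\<integral>x. R x \<partial>I1)"
      by (rule Bochner_Integration.integral_cong[OF refl]) (rule R)
    then show ?thesis using sums_integral[OF int AE_summable summable_int] by simp
  qed
  show "integrable I1 R"
  proof -
    have "integrable I1 (\<lambda>x. \<Sum>k. z ^ k *\<^sub>R iter x k (\<lambda>_. v)) \<longleftrightarrow> integrable I1 R"
      by (rule Bochner_Integration.integrable_cong[OF refl]) (rule R)
    then show ?thesis using integrable_suminf[OF int AE_summable summable_int] by simp
  qed
qed

end


section \<open>From the differential equation back to the integral equation\<close>

context bounded_linear_pair
begin

text \<open>For fixed s the kernel is the constant x minus the indicator of y \<le> s, so
  \<open>trans x \<Phi> s\<close> is x times the full integral minus the integral over [0, s]; the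
  integrated differential equation evaluates both. If moreover v = (1 - x) \<Phi>(0) + x \<Phi>(2),
  the result rearranges to \<open>\<Phi> s = v + z *\<^sub>R trans x \<Phi> s\<close>.\<close>

lemma trans_eq:
  assumes x: "x \<in> {0..1}" and \<Phi>: "\<Phi> \<in> borel_measurable borel"
    and B: "\<And>s. s \<in> {0..2} \<Longrightarrow> norm (\<Phi> s) \<le> B"
    and int: "\<And>s. s \<in> {0..2} \<Longrightarrow> ((\<lambda>y. z *\<^sub>R dens y (\<Phi> y)) has_integral (\<Phi> 0 - \<Phi> s)) {0..s}"
  shows "z *\<^sub>R (\<integral>y. dens y (\<Phi> y) \<partial>I2) = \<Phi> 0 - \<Phi> 2"
    and "s \<in> {0..<2} \<Longrightarrow> z *\<^sub>R trans x \<Phi> s = x *\<^sub>R (\<Phi> 0 - \<Phi> 2) - (\<Phi> 0 - \<Phi> s)"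
proof -
  let ?H = "\<lambda>y. dens y (\<Phi> y)"
  have B': "norm (\<Phi> s) \<le> B" if "s \<in> {0..<2}" for s using B that by auto
  have i2: "integrable I2 ?H" by (rule dens_integrable(2)[OF x \<Phi> B'])
  then have s2: "set_integrable lborel {0..<2} ?H"
    by (simp add: set_integrable_def integrable_restrict_space)
  have I: "(LINT y:{0..<2}|lborel. ?H y) = (\<integral>y. ?H y \<partial>I2)"
    by (simp add: set_lebesgue_integral_def integral_restrict_space)
  have "(LINT y:{0..<2}|lborel. z *\<^sub>R ?H y) = integral {0..<2} (\<lambda>y. z *\<^sub>R ?H y)"
    by (rule set_borel_integral_eq_integral(2)) (use s2 in \<open>simp add: set_integrable_scaleR_right\<close>)
  also have "\<dots> = integral {0..2} (\<lambda>y. z *\<^sub>R ?H y)"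
    by (rule integral_spike_set; rule negligible_subset[of "{2}"]) auto
  also have "\<dots> = \<Phi> 0 - \<Phi> 2"
    using int[of 2] by (intro integral_unique) auto
  finally have "(LINT y:{0..<2}|lborel. z *\<^sub>R ?H y) = \<Phi> 0 - \<Phi> 2" .
  then show full: "z *\<^sub>R (\<integral>y. ?H y \<partial>I2) = \<Phi> 0 - \<Phi> 2"
    unfolding I[symmetric] by (simp add: set_lebesgue_integral_def scaleR_left_commute[of _ z])
  show "z *\<^sub>R trans x \<Phi> s = x *\<^sub>R (\<Phi> 0 - \<Phi> 2) - (\<Phi> 0 - \<Phi> s)" if s: "s \<in> {0..<2}"
  proof -
    have ss: "set_integrable lborel {0..s} ?H"
      using s2 by (rule set_integrable_subset) (use s in auto)
    have "(LINT y:{0..s}|lborel. z *\<^sub>R ?H y) = integral {0..s} (\<lambda>y. z *\<^sub>R ?H y)"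
      by (rule set_borel_integral_eq_integral(2)) (use ss in \<open>simp add: set_integrable_scaleR_right\<close>)
    also have "\<dots> = \<Phi> 0 - \<Phi> s"
      using int[of s] s by (intro integral_unique) auto
    finally have part: "z *\<^sub>R (LINT y:{0..s}|lborel. ?H y) = \<Phi> 0 - \<Phi> s"
      by (simp add: set_lebesgue_integral_def scaleR_left_commute[of _ z])
    have e: "indicator {0..<2} y *\<^sub>R (jump x s y *\<^sub>R ?H y)
        = x *\<^sub>R (indicator {0..<2} y *\<^sub>R ?H y) - indicator {0..s} y *\<^sub>R ?H y" for y :: real
      using s by (auto simp: jump_def indicator_def algebra_simps)
    have "trans x \<Phi> s = (LINT y|lborel. indicator {0..<2} y *\<^sub>R (jump x s y *\<^sub>R ?H y))"
      by (simp add: trans_def integral_restrict_space)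
    also have "\<dots> = x *\<^sub>R (\<integral>y. ?H y \<partial>I2) - (LINT y:{0..s}|lborel. ?H y)"
      unfolding e using s2 ss
      by (simp add: set_integrable_def I[symmetric] set_lebesgue_integral_def del: scaleR_scaleR)
    finally have "z *\<^sub>R trans x \<Phi> s = x *\<^sub>R (z *\<^sub>R (\<integral>y. ?H y \<partial>I2)) - z *\<^sub>R (LINT y:{0..s}|lborel. ?H y)"
      by (simp add: scaleR_diff_right mult.commute)
    then show ?thesis by (simp only: full part)
  qed
qed

end

section \<open>The generating function of the triangular BCH terms\<close>

text \<open>This is the matrix (a, u; 0, -a) acting on column vectors, written as pairs.\<close>

definition triangular_action :: "real \<Rightarrow> real \<Rightarrow> real \<times> real \<Rightarrow> real \<times> real" where
  "triangular_action a u w = (a * fst w + u * snd w, - a * snd w)"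

lemma bounded_linear_triangular_action: "bounded_linear (triangular_action a u)"
  unfolding triangular_action_def[abs_def]
  by (intro bounded_linear_Pair bounded_linear_add bounded_linear_const_mult bounded_linear_fst bounded_linear_snd)

lemma bounded_linear_pair_exists:
  assumes "bounded_linear F" "bounded_linear G"
  obtains C where "bounded_linear_pair F G C"
proof -
  obtain K L where "0 < K" "\<And>w. norm (F w) \<le> norm w * K" "0 < L" "\<And>w. norm (G w) \<le> norm w * L"
    using bounded_linear.pos_bounded[OF assms(1)] bounded_linear.pos_bounded[OF assms(2)] by blast
  then have "norm (F w) \<le> max K L * norm w" "norm (G w) \<le> max K L * norm w" for w
    by (smt (verit) mult.commute mult_left_mono norm_ge_zero)+
  then have "bounded_linear_pair F G (max K L)"
    using assms \<open>0 < K\<close> unfolding bounded_linear_pair_def by auto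
  then show ?thesis by (rule that)
qed

text \<open>The off-diagonal entry of \<open>exp (z A) exp (z B)\<close> for \<open>A = (a, u; 0, -a)\<close> and \<open>B = (b, v; 0, -b)\<close>.\<close>

definition bch_numerator :: "real \<Rightarrow> real \<Rightarrow> real \<Rightarrow> real \<Rightarrow> real \<Rightarrow> real" where
  "bch_numerator a u b v z =
     u / (2 * a) * (exp ((a - b) * z) - exp (- (a + b) * z)) +
     v / (2 * b) * (exp ((a + b) * z) - exp ((a - b) * z))"

locale triangular_pair =
  fixes a u b v C :: real
  assumes a: "0 < a" and b: "0 < b"
    and pair: "bounded_linear_pair (triangular_action a u) (triangular_action b v) C"

sublocale triangular_pair \<subseteq> bounded_linear_pair "triangular_action a u" "triangular_action b v" C
  by (rule pair)

context triangular_pair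
begin

text \<open>If a scalar function is multiplied by \<open>exp z\<close> on its way from 0 to 2, the
  boundary form (1 - x) \<Phi>(0) + x \<Phi>(2) multiplies its initial value by this number. As a
  convex combination of 1 and \<open>exp z\<close> it is positive for x in [0, 1], so the boundary
  value problem is solvable.\<close>

definition denom :: "real \<Rightarrow> real \<Rightarrow> real" where
  "denom z x = 1 - x + x * exp z"

lemma denom_pos: "x \<in> {0..1} \<Longrightarrow> 0 < denom z x"
  unfolding denom_def by (cases "x = 0") (auto intro!: add_nonneg_pos)

text \<open>The system is triangular: the second component Q satisfies a scalar equation and then
  drives the first component P. The coefficients -k1 and -k2 give particular solutions of the
  equation for P on the two halves, as -k1 Q solves P' = -z (a P + 2 a k1 Q) whenever Q' = z a
  Q.\<close>

lemma solution_exists: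
  fixes z x :: real
  assumes x: "x \<in> {0..1}"
  obtains \<Phi> B where "\<Phi> \<in> borel_measurable borel" "\<forall>s\<in>{0..2}. norm (\<Phi> s) \<le> B"
    "\<forall>s\<in>{0..2}. ((\<lambda>y. z *\<^sub>R dens y (\<Phi> y)) has_integral (\<Phi> 0 - \<Phi> s)) {0..s}"
    "(1 - x) *\<^sub>R \<Phi> 0 + x *\<^sub>R \<Phi> 2 = (0, 1)"
    "fst (\<Phi> 0 - \<Phi> 2) = bch_numerator a u b v z / (denom ((a + b) * z) x * denom (- ((a + b) * z)) x)"
proof -
  define k1 where "k1 = u / (2 * a)"
  define k2 where "k2 = v / (2 * b)"
  have u: "u = 2 * a * k1" and v: "v = 2 * b * k2" using a b by (simp_all add: k1_def k2_def)
  define X where "X = bch_numerator a u b v z"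
  define D1 where "D1 = denom ((a + b) * z) x"
  define D2 where "D2 = denom (- ((a + b) * z)) x"
  have D: "D1 \<noteq> 0" "D2 \<noteq> 0" using denom_pos[OF x] by (auto simp: D1_def D2_def less_le)
  \<comment> \<open>Both initial values are forced by the boundary condition. Q grows by exp((a + b)
    z), so its equation reads \<open>Q0 * D1 = 1\<close>. For P, where P(2) = exp(-(a + b) z) P(0) -
    Q0 X, it reads \<open>P0 * D2 = x * Q0 * X\<close>.\<close>
  define Q0 where "Q0 = 1 / D1"
  define P0 where "P0 = x * X / (D1 * D2)"
  define S0 where "S0 = P0 + k1 * Q0"
  \<comment> \<open>The coefficients of the homogeneous solutions: \<open>S0\<close> gives P(0) =
    P0, and \<open>S1\<close> makes P continuous at s = 1, where the density changes.\<close>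
  define S1 where "S1 = S0 * exp (- a * z) - k1 * Q0 * exp (a * z) + k2 * Q0 * exp (a * z)"
  define Q where "Q s = (if s \<le> 1 then Q0 * exp (a * z * s) else Q0 * exp (a * z) * exp (b * z * (s - 1)))" for s
  define P where "P s = (if s \<le> 1 then S0 * exp (- a * z * s) - k1 * Q0 * exp (a * z * s)
      else S1 * exp (- b * z * (s - 1)) - k2 * Q0 * exp (a * z) * exp (b * z * (s - 1)))" for s
  define \<Phi> where "\<Phi> s = (P s, Q s)" for s
  have cQ: "continuous_on UNIV Q"
  proof -
    have "continuous_on ({..1} \<union> {1..}) Q"
      unfolding Q_def[abs_def]
      by (rule continuous_on_If) (auto intro!: continuous_intros)
    moreover have "{..1} \<union> {1..} = (UNIV :: real set)" by auto
    ultimately show ?thesis by simp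
  qed
  have cP: "continuous_on UNIV P"
  proof -
    have "continuous_on ({..1} \<union> {1..}) P"
      unfolding P_def[abs_def]
      by (rule continuous_on_If) (auto intro!: continuous_intros simp: S1_def)
    moreover have "{..1} \<union> {1..} = (UNIV :: real set)" by auto
    ultimately show ?thesis by simp
  qed
  have c\<Phi>: "continuous_on UNIV \<Phi>"
    unfolding \<Phi>_def[abs_def] by (rule continuous_on_Pair[OF cP cQ])
  have meas: "\<Phi> \<in> borel_measurable borel"
    by (rule borel_measurable_continuous_onI[OF c\<Phi>])
  have "compact (\<Phi> ` {0..2})"
    by (rule compact_continuous_image[OF continuous_on_subset[OF c\<Phi>]]) auto
  then obtain B where B: "\<And>s. s \<in> {0..2} \<Longrightarrow> norm (\<Phi> s) \<le> B"
    using compact_imp_bounded bounded_iff by (metis imageI)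
  \<comment> \<open>At s = 1 the density jumps; for the fundamental theorem of calculus it is enough
    that \<Phi> is continuous there.\<close>
  have der: "(\<Phi> has_vector_derivative (- (z *\<^sub>R dens s (\<Phi> s)))) (at s)" if "s \<noteq> 1" for s
  proof (cases "s < 1")
    case True
    let ?P = "\<lambda>s. S0 * exp (- a * z * s) - k1 * Q0 * exp (a * z * s)" and ?Q = "\<lambda>s. Q0 * exp (a * z * s)"
    have "((\<lambda>s. (?P s, ?Q s)) has_vector_derivative
       (- (z * (a * ?P s + u * ?Q s)), z * a * ?Q s)) (at s)"
      by (rule has_vector_derivative_Pair; unfold has_real_derivative_iff_has_vector_derivative[symmetric])
         (rule derivative_eq_intros refl | simp add: u algebra_simps)+
    then have "(\<Phi> has_vector_derivative (- (z * (a * ?P s + u * ?Q s)), z * a * ?Q s)) (at s)"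
      by (rule has_vector_derivative_transform_within_open[of _ _ _ "{..<1}"])
         (use True in \<open>auto simp: \<Phi>_def P_def Q_def\<close>)
    then show ?thesis using True
      by (simp add: dens_def triangular_action_def \<Phi>_def P_def Q_def mult.assoc)
  next
    case False
    then have s: "1 < s" using that by simp
    let ?P = "\<lambda>s. S1 * exp (- b * z * (s - 1)) - k2 * Q0 * exp (a * z) * exp (b * z * (s - 1))"
    let ?Q = "\<lambda>s. Q0 * exp (a * z) * exp (b * z * (s - 1))"
    have "((\<lambda>s. (?P s, ?Q s)) has_vector_derivative
       (- (z * (b * ?P s + v * ?Q s)), z * b * ?Q s)) (at s)"
      by (rule has_vector_derivative_Pair; unfold has_real_derivative_iff_has_vector_derivative[symmetric])
         (rule derivative_eq_intros refl | simp add: v algebra_simps)+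
    then have "(\<Phi> has_vector_derivative (- (z * (b * ?P s + v * ?Q s)), z * b * ?Q s)) (at s)"
      by (rule has_vector_derivative_transform_within_open[of _ _ _ "{1<..}"])
         (use s in \<open>auto simp: \<Phi>_def P_def Q_def\<close>)
    then show ?thesis using s
      by (simp add: dens_def triangular_action_def \<Phi>_def P_def Q_def mult.assoc)
  qed
  have int: "((\<lambda>y. z *\<^sub>R dens y (\<Phi> y)) has_integral (\<Phi> 0 - \<Phi> s)) {0..s}" if "s \<in> {0..2}" for s
  proof -
    have "((\<lambda>y. - (z *\<^sub>R dens y (\<Phi> y))) has_integral (\<Phi> s - \<Phi> 0)) {0..s}"
      by (rule fundamental_theorem_of_calculus_interior_strong[of "{1}"])
         (use that der continuous_on_subset[OF c\<Phi>] in auto)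
    from has_integral_neg[OF this] show ?thesis by simp
  qed
  have "Q 0 = Q0" "Q 2 = Q0 * exp ((a + b) * z)"
    by (simp_all add: Q_def algebra_simps exp_add[symmetric])
  then have "(1 - x) * Q 0 + x * Q 2 = Q0 * D1"
    by (simp add: D1_def denom_def algebra_simps)
  then have Qcond: "(1 - x) * Q 0 + x * Q 2 = 1" using D by (simp add: Q0_def)
  have P_0: "P 0 = P0" by (simp add: P_def S0_def)
  have P_2: "P 2 = exp (- (a + b) * z) * P0 - Q0 * X"
  proof -
    have X: "X = k1 * (exp (a * z) * exp (- b * z) - exp (- a * z) * exp (- b * z))
        + k2 * (exp (a * z) * exp (b * z) - exp (a * z) * exp (- b * z))"
      unfolding X_def bch_numerator_def k1_def k2_def
      by (simp add: exp_add[symmetric] algebra_simps)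
    have E: "exp (- (a + b) * z) = exp (- a * z) * exp (- b * z)"
      by (simp add: exp_add[symmetric] algebra_simps)
    have "P 2 = S1 * exp (- b * z) - k2 * Q0 * exp (a * z) * exp (b * z)"
      by (simp add: P_def)
    then show ?thesis
      unfolding E X S1_def S0_def by (simp add: algebra_simps)
  qed
  have "x * P 2 = (x * exp (- (a + b) * z)) * P0 - x * Q0 * X"
    by (simp only: P_2 right_diff_distrib mult.assoc)
  also have "x * exp (- (a + b) * z) = D2 - (1 - x)"
    unfolding D2_def denom_def by (simp add: mult_minus_left[symmetric] del: mult_minus_left)
  also have "x * Q0 * X = P0 * D2" using D by (simp add: P0_def Q0_def)
  finally have Pcond: "(1 - x) * P 0 + x * P 2 = 0" by (simp add: P_0 algebra_simps)
  \<comment> \<open>For x \<noteq> 0 the boundary condition says x (P(0) - P(2)) = P(0), and x can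
    be cancelled; at x = 0 the difference is read off from the formula for P(2).\<close>
  have "P 0 - P 2 = X / (D1 * D2)"
  proof (cases "x = 0")
    case True
    then show ?thesis using P_2 P_0 by (simp add: P0_def Q0_def D2_def denom_def)
  next
    case False
    have "x * (P 0 - P 2) = P0" using Pcond by (simp add: P_0 algebra_simps)
    then have "x * (P 0 - P 2) = x * (X / (D1 * D2))" by (simp add: P0_def)
    then show ?thesis by (rule mult_left_cancel[OF False, THEN iffD1])
  qed
  with Pcond Qcond have "(1 - x) *\<^sub>R \<Phi> 0 + x *\<^sub>R \<Phi> 2 = (0, 1)"
    "fst (\<Phi> 0 - \<Phi> 2) = bch_numerator a u b v z / (denom ((a + b) * z) x * denom (- ((a + b) * z)) x)"
    by (simp_all add: \<Phi>_def X_def D1_def D2_def)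
  with meas B int show ?thesis by (intro that) blast+
qed

text \<open>Partial fractions: the integrand times exp(c) - exp(-c) is the derivative of ln(denom c
  x) - ln(denom (-c) x), which goes from 0 at x = 0 to c - (-c) at x = 1. The product form also
  covers c = 0.\<close>

lemma integral_inverse_denom:
  "(exp c - exp (- c)) * (\<integral>x. 1 / (denom c x * denom (- c) x) \<partial>I1) = 2 * c"
proof -
  let ?f = "\<lambda>x. (exp c - exp (- c)) * (1 / (denom c x * denom (- c) x))"
  have cont: "continuous_on {0..1} (denom c)" "continuous_on {0..1} (denom (- c))"
    unfolding denom_def by (auto intro!: continuous_intros)
  have nz: "denom c x \<noteq> 0" "denom (- c) x \<noteq> 0" if "x \<in> {0..1}" for x
    using denom_pos[OF that] by (auto simp: less_le)
  have "(?f has_integral (ln (denom c 1) - ln (denom (- c) 1)) - (ln (denom c 0) - ln (denom (- c) 0))) {0..1}"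
  proof (rule fundamental_theorem_of_calculus)
    fix x :: real assume x: "x \<in> {0..1}"
    have "((\<lambda>x. ln (denom c x) - ln (denom (- c) x)) has_field_derivative
        (exp c - 1) / denom c x - (exp (- c) - 1) / denom (- c) x) (at x within {0..1})"
      using denom_pos[OF x, unfolded denom_def] unfolding denom_def
      by (auto intro!: derivative_eq_intros)
    also have "(exp c - 1) / denom c x - (exp (- c) - 1) / denom (- c) x
        = ((exp c - 1) * denom (- c) x - (exp (- c) - 1) * denom c x) / (denom c x * denom (- c) x)"
      using nz[OF x] by (simp add: field_simps)
    also have "(exp c - 1) * denom (- c) x - (exp (- c) - 1) * denom c x = exp c - exp (- c)"
      unfolding denom_def by (simp add: algebra_simps)
    finally show "((\<lambda>x. ln (denom c x) - ln (denom (- c) x)) has_vector_derivative ?f x) (at x within {0..1})"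
      by (simp add: has_real_derivative_iff_has_vector_derivative)
  qed simp
  then have "integral {0..1} ?f = 2 * c"
    by (intro integral_unique) (simp add: denom_def)
  moreover have "(LINT x:{0..1}|lborel. ?f x) = integral {0..1} ?f"
    by (rule set_borel_integral_eq_integral(2), rule borel_integrable_atLeastAtMost')
       (use nz cont in \<open>auto intro!: continuous_intros\<close>)
  moreover have "(LINT x:{0..1}|lborel. ?f x) = (\<integral>x. ?f x \<partial>I1)"
    by (simp add: set_lebesgue_integral_def integral_restrict_space)
  moreover have "(\<integral>x. ?f x \<partial>I1) = (exp c - exp (- c)) * (\<integral>x. 1 / (denom c x * denom (- c) x) \<partial>I1)"
    by (rule integral_mult_right_zero)
  ultimately show ?thesis by simp
qed

text \<open>As \<open>iter x k\<close> belongs to the Magnus term of index k + 1, it is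
  \<open>z * S\<close> that sums the off-diagonal entries with their proper powers of z. For each x
  the solution contributes X(z) times the reciprocal of the two denominators, so the average over x
  is the integral just computed. The factor z is cancelled at the end, whence z \<noteq> 0.\<close>

lemma bch_generating_function:
  assumes z: "z \<noteq> 0" "\<bar>z\<bar> * (2 * C) < 1"
  obtains S where "(\<lambda>k. fst (\<integral>x. iter x k (\<lambda>_. (0, 1)) \<partial>I1) * z ^ k) sums S"
    "S * (exp ((a + b) * z) - exp (- ((a + b) * z))) = 2 * (a + b) * bch_numerator a u b v z"
proof -
  let ?c = "(a + b) * z"
  have "\<forall>x\<in>{0..1}. \<exists>r. (\<lambda>k. z ^ k *\<^sub>R iter x k (\<lambda>_. (0, 1))) sums r \<and>
      z * fst r = bch_numerator a u b v z * (1 / (denom ?c x * denom (- ?c) x))"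
  proof
    fix x :: real assume x: "x \<in> {0..1}"
    obtain \<Phi> B where meas: "\<Phi> \<in> borel_measurable borel" and bnd: "\<forall>s\<in>{0..2}. norm (\<Phi> s) \<le> B"
      and int: "\<forall>s\<in>{0..2}. ((\<lambda>y. z *\<^sub>R dens y (\<Phi> y)) has_integral (\<Phi> 0 - \<Phi> s)) {0..s}"
      and bc: "(1 - x) *\<^sub>R \<Phi> 0 + x *\<^sub>R \<Phi> 2 = (0, 1)"
      and f: "fst (\<Phi> 0 - \<Phi> 2) = bch_numerator a u b v z / (denom ((a + b) * z) x * denom (- ((a + b) * z)) x)"
      using solution_exists[OF x, of z] by blast
    note \<Phi> = meas bspec[OF bnd] bspec[OF int]
    have "(\<lambda>k. z ^ k *\<^sub>R iter x k (\<lambda>_. (0, 1))) sums (\<integral>y. dens y (\<Phi> y) \<partial>I2)"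
    proof (rule iter_sums[OF x \<Phi>(1) _ _ z(2)])
      fix s :: real assume s: "s \<in> {0..<2}"
      then show "norm (\<Phi> s) \<le> B" by (intro \<Phi>(2)) auto
      have "z *\<^sub>R trans x \<Phi> s = x *\<^sub>R (\<Phi> 0 - \<Phi> 2) - (\<Phi> 0 - \<Phi> s)"
        by (rule trans_eq(2)[OF x \<Phi> s])
      then show "\<Phi> s = (0, 1) + z *\<^sub>R trans x \<Phi> s"
        unfolding bc[symmetric] by (simp add: algebra_simps)
    qed
    moreover have "z *\<^sub>R (\<integral>y. dens y (\<Phi> y) \<partial>I2) = \<Phi> 0 - \<Phi> 2"
      by (rule trans_eq(1)[OF x \<Phi>])
    then have "z * fst (\<integral>y. dens y (\<Phi> y) \<partial>I2) = fst (\<Phi> 0 - \<Phi> 2)"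
      by (metis fst_scaleR real_scaleR_def)
    ultimately show "\<exists>r. (\<lambda>k. z ^ k *\<^sub>R iter x k (\<lambda>_. (0, 1))) sums r \<and>
      z * fst r = bch_numerator a u b v z * (1 / (denom ?c x * denom (- ?c) x))"
      using f by (intro exI conjI) (assumption, simp)
  qed
  from bchoice[OF this] obtain R where R: "\<And>x. x \<in> {0..1} \<Longrightarrow> (\<lambda>k. z ^ k *\<^sub>R iter x k (\<lambda>_. (0, 1))) sums R x"
    "\<And>x. x \<in> {0..1} \<Longrightarrow> z * fst (R x) = bch_numerator a u b v z * (1 / (denom ?c x * denom (- ?c) x))"
    by blast
  have sums: "(\<lambda>k. z ^ k *\<^sub>R (\<integral>x. iter x k (\<lambda>_. (0, 1)) \<partial>I1)) sums (\<integral>x. R x \<partial>I1)"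
    by (rule integral_iter_sums(1)[OF R(1) z(2)])
  define S where "S = fst (\<integral>x. R x \<partial>I1)"
  have "(\<lambda>k. fst (z ^ k *\<^sub>R (\<integral>x. iter x k (\<lambda>_. (0, 1)) \<partial>I1))) sums S"
    unfolding S_def by (rule bounded_linear.sums[OF bounded_linear_fst sums])
  then have S: "(\<lambda>k. fst (\<integral>x. iter x k (\<lambda>_. (0, 1)) \<partial>I1) * z ^ k) sums S"
    by (simp add: mult.commute)
  have "S = (\<integral>x. fst (R x) \<partial>I1)"
    unfolding S_def
    using integral_bounded_linear[OF bounded_linear_fst integral_iter_sums(2)[OF R(1) z(2)]] by simp
  then have "z * S = (\<integral>x. z * fst (R x) \<partial>I1)" by simp
  also have "\<dots> = (\<integral>x. bch_numerator a u b v z * (1 / (denom ?c x * denom (- ?c) x)) \<partial>I1)"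
    by (rule Bochner_Integration.integral_cong[OF refl]) (use R(2) in auto)
  also have "\<dots> = bch_numerator a u b v z * (\<integral>x. 1 / (denom ?c x * denom (- ?c) x) \<partial>I1)"
    by (rule integral_mult_right_zero)
  finally have zS: "z * S = bch_numerator a u b v z * (\<integral>x. 1 / (denom ?c x * denom (- ?c) x) \<partial>I1)" .
  have "z * (S * (exp ?c - exp (- ?c))) = (z * S) * (exp ?c - exp (- ?c))"
    by (rule mult.assoc[symmetric])
  also have "\<dots> = bch_numerator a u b v z *
      ((exp ?c - exp (- ?c)) * (\<integral>x. 1 / (denom ?c x * denom (- ?c) x) \<partial>I1))"
    unfolding zS by (simp only: mult_ac)
  also have "\<dots> = z * (2 * (a + b) * bch_numerator a u b v z)"
    unfolding integral_inverse_denom by (simp add: mult_ac)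
  finally have "S * (exp ?c - exp (- ?c)) = 2 * (a + b) * bch_numerator a u b v z"
    using z(1) by simp
  with S show ?thesis by (intro that) simp_all
qed

end


section \<open>Off-diagonal entries of the BCH terms\<close>

lemma bounded_linear_matrix_mult_right:
  fixes A :: "'a::{real_normed_field, euclidean_space} ^ 'n ^ 'n"
  shows "bounded_linear (\<lambda>M. A ** M)"
proof -
  have "linear (\<lambda>M. A ** M)"
  proof (rule linearI)
    show "A ** (x + y) = A ** x + A ** y" for x y by (simp add: matrix_add_ldistrib)
    show "A ** (r *\<^sub>R b) = r *\<^sub>R (A ** b)" for r b
      by (simp add: vec_eq_iff matrix_matrix_mult_def scaleR_sum_right)
  qed
  then show ?thesis by (simp only: linear_conv_bounded_linear)
qed

lemma bounded_linear_entry: "bounded_linear (\<lambda>M :: 'a::{real_normed_field, euclidean_space} ^ 'n ^ 'm. M $ i $ j)"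
  unfolding linear_conv_bounded_linear[symmetric] by (rule linearI) simp_all

text \<open>Needed to take entries under the Bochner integral. An ordered product is a word in the
  left multiplications by \<open>A\<close> and \<open>B\<close>, applied to
  \<open>mat 1\<close>.\<close>

lemma bch_integrand_integrable:
  fixes A B :: "'a::{real_normed_field, euclidean_space} ^ 'n ^ 'n"
  shows "integrable (I2pow (Suc k)) (\<lambda>t. ((-1) ^ des (Suc k) t *
    (fact (asc (Suc k) t) * fact (des (Suc k) t) / fact (Suc k))) *\<^sub>R
    ordered_product (\<lambda>t. if t < 1 then A else B) (Suc k) t)"
proof -
  obtain C where "bounded_linear_pair (\<lambda>M :: 'a ^ 'n ^ 'n. A ** M) (\<lambda>M :: 'a ^ 'n ^ 'n. B ** M) C"
    using bounded_linear_pair_exists[OF bounded_linear_matrix_mult_right bounded_linear_matrix_mult_right] .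
  then interpret bounded_linear_pair "\<lambda>M :: 'a ^ 'n ^ 'n. A ** M" "\<lambda>M :: 'a ^ 'n ^ 'n. B ** M" C .
  have "ordered_product (\<lambda>t. if t < 1 then A else B) (Suc k) t = word (Suc k) t (mat 1)" for t
    unfolding ordered_product_def word_def dens_def[abs_def]
    by (intro foldr_cong refl) (auto intro!: ext)
  then show ?thesis using weight_word_integrable[of k "mat 1"] by simp
qed

lemma bch_term_entry:
  fixes A B :: "'a::{real_normed_field, euclidean_space} ^ 'n ^ 'n"
  shows "bch_term A B (Suc k) $ i $ j = (\<integral>t. ((-1) ^ des (Suc k) t *
    (fact (asc (Suc k) t) * fact (des (Suc k) t) / fact (Suc k))) *\<^sub>R
    ordered_product (\<lambda>t. if t < 1 then A else B) (Suc k) t $ i $ j \<partial>I2pow (Suc k))"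
  unfolding bch_term_def magnus_term_def
  using integral_bounded_linear[OF bounded_linear_entry[of i j] bch_integrand_integrable[of k A B]] by simp

lemma ordered_product_upper_triangular:
  fixes h :: "real \<Rightarrow> 'a::{real_normed_field, euclidean_space} ^ 2 ^ 2"
  assumes "\<And>s. h s \<in> upper_triangular"
  shows "ordered_product h k t \<in> upper_triangular"
proof -
  have "foldr (\<lambda>i B. h (t i) ** B) xs (mat 1) \<in> upper_triangular" for xs
    using assms by (induction xs) (auto simp: upper_triangular_def matrix_matrix_mult_def sum_2 mat_def)
  then show ?thesis by (simp add: ordered_product_def)
qed

lemma bch_term_upper_triangular:
  fixes A B :: "'a::{real_normed_field, euclidean_space} ^ 2 ^ 2"
  assumes "A \<in> upper_triangular" "B \<in> upper_triangular"
  shows "bch_term A B (Suc k) \<in> upper_triangular"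
proof -
  have "ordered_product (\<lambda>t. if t < 1 then A else B) (Suc k) t $ 2 $ 1 = 0" for t
    using ordered_product_upper_triangular[of "\<lambda>t. if t < 1 then A else B" "Suc k" t] assms
    by (simp add: upper_triangular_def)
  then show ?thesis
    by (simp add: upper_triangular_def bch_term_entry)
qed

text \<open>The second column of an ordered product is the product applied to (0, 1). For these
  matrices that is a computation with real numbers, so the scalar field enters through
  \<open>of_real\<close> alone.\<close>

lemma (in triangular_pair) bch_term_off_diagonal:
  "bch_term (mat22 (of_real a) (of_real u) 0 (of_real (- a)) :: 'a::{real_normed_field, euclidean_space} ^ 2 ^ 2)
     (mat22 (of_real b) (of_real v) 0 (of_real (- b))) (Suc k) $ 1 $ 2
   = of_real (fst (\<integral>x. iter x k (\<lambda>_. (0, 1)) \<partial>I1))"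
proof -
  define h :: "real \<Rightarrow> 'a ^ 2 ^ 2" where "h t = (if t < 1 then mat22 (of_real a) (of_real u) 0 (of_real (- a))
     else mat22 (of_real b) (of_real v) 0 (of_real (- b)))" for t
  let ?w = "\<lambda>t. (-1) ^ des (Suc k) t * (fact (asc (Suc k) t) * fact (des (Suc k) t) / fact (Suc k)) :: real"
  have mult: "(X ** Y) $ 1 $ 2 = X $ 1 $ 1 * Y $ 1 $ 2 + X $ 1 $ 2 * Y $ 2 $ 2"
    "(X ** Y) $ 2 $ 2 = X $ 2 $ 1 * Y $ 1 $ 2 + X $ 2 $ 2 * Y $ 2 $ 2" for X Y :: "'a ^ 2 ^ 2"
    by (simp_all add: matrix_matrix_mult_def sum_2)
  have h: "h s $ 1 $ 1 = of_real (if s < 1 then a else b)" "h s $ 1 $ 2 = of_real (if s < 1 then u else v)"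
    "h s $ 2 $ 1 = 0" "h s $ 2 $ 2 = of_real (- (if s < 1 then a else b))" for s
    by (simp_all add: h_def)
  have dens: "fst (dens s w) = (if s < 1 then a else b) * fst w + (if s < 1 then u else v) * snd w"
    "snd (dens s w) = - (if s < 1 then a else b) * snd w" for s w
    by (simp_all add: dens_def triangular_action_def)
  have "foldr (\<lambda>i B. h (t i) ** B) xs (mat 1) $ 1 $ 2 = of_real (fst (foldr (\<lambda>i. dens (t i)) xs (0, 1))) \<and>
    foldr (\<lambda>i B. h (t i) ** B) xs (mat 1) $ 2 $ 2 = of_real (snd (foldr (\<lambda>i. dens (t i)) xs (0, 1)))"
    for t :: "nat \<Rightarrow> real" and xs
    by (induction xs) (simp_all add: mult h dens del: if_split, simp add: mat_def)
  then have entry: "ordered_product h (Suc k) t $ 1 $ 2 = of_real (fst (word (Suc k) t (0, 1)))" for t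
    by (simp add: ordered_product_def word_def del: upt_Suc)
  have int: "integrable (I2pow (Suc k)) (\<lambda>t. ?w t *\<^sub>R word (Suc k) t (0, 1))"
    by (rule weight_word_integrable)
  have "bounded_linear (\<lambda>w. of_real (fst w) :: 'a)"
    by (rule bounded_linear_compose[OF bounded_linear_of_real bounded_linear_fst])
  from integral_bounded_linear[OF this int]
  have "(\<integral>t. ?w t *\<^sub>R ordered_product h (Suc k) t $ 1 $ 2 \<partial>I2pow (Suc k))
      = of_real (fst (\<integral>x. iter x k (\<lambda>_. (0, 1)) \<partial>I1))"
    unfolding integral_weight_word by (simp add: entry scaleR_conv_of_real)
  then show ?thesis
    unfolding bch_term_entry h_def[abs_def] .
qed

text \<open>Once the lower coefficients vanish, division by z^k leaves a series that is 0 on a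
  punctured neighbourhood and tends to \<open>d k\<close> at 0. The point z = 0 is excluded to match
  the generating function.\<close>

lemma powser_eq_0:
  fixes d :: "nat \<Rightarrow> real"
  assumes "0 < \<eta>" "\<And>z. z \<noteq> 0 \<Longrightarrow> \<bar>z\<bar> < \<eta> \<Longrightarrow> (\<lambda>k. d k * z ^ k) sums 0"
  shows "d k = 0"
proof (induction k rule: less_induct)
  case (less k)
  have "((\<lambda>z::real. 0 :: real) \<longlongrightarrow> d (0 + k)) (at 0)"
  proof (rule powser_limit_0_strong[OF assms(1)])
    fix z :: real assume z: "z \<noteq> 0" "norm z < \<eta>"
    have "(\<lambda>n. d (n + k) * z ^ (n + k)) sums 0"
      using assms(2)[of z] z less sums_zero_iff_shift[of k "\<lambda>n. d n * z ^ n" 0] by simp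
    then have "(\<lambda>n. inverse (z ^ k) * (d (n + k) * z ^ (n + k))) sums (inverse (z ^ k) * 0)"
      by (rule sums_mult)
    then show "(\<lambda>n. d (n + k) * z ^ n) sums 0"
      using z(1) by (simp add: power_add field_simps)
  qed
  then show ?case by (simp add: tendsto_const_iff)
qed

lemma exp_sums:
  fixes z :: "'b::{real_normed_field, banach}"
  shows "(\<lambda>k. of_real (c ^ k / fact k) * z ^ k) sums exp (of_real c * z)"
    and "summable (\<lambda>k. norm (of_real (c ^ k / fact k) * z ^ k))"
proof -
  have e: "of_real (c ^ k / fact k) * z ^ k = (of_real c * z) ^ k /\<^sub>R fact k" for k
    by (simp add: power_mult_distrib scaleR_conv_of_real field_simps)
  show "(\<lambda>k. of_real (c ^ k / fact k) * z ^ k) sums exp (of_real c * z)"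
    unfolding e by (rule exp_converges)
  show "summable (\<lambda>k. norm (of_real (c ^ k / fact k) * z ^ k))"
    unfolding e by (rule summable_norm_exp)
qed

lemma exp_diff_sums:
  fixes z :: "'b::{real_normed_field, banach}"
  shows "(\<lambda>k. of_real (c ^ k / fact k - d ^ k / fact k) * z ^ k) sums (exp (of_real c * z) - exp (of_real d * z))"
    and "summable (\<lambda>k. norm (of_real (c ^ k / fact k - d ^ k / fact k) * z ^ k))"
proof -
  have e: "of_real (c ^ k / fact k - d ^ k / fact k) * z ^ k
      = of_real (c ^ k / fact k) * z ^ k - of_real (d ^ k / fact k) * z ^ k" for k
    by (simp only: of_real_diff left_diff_distrib)
  show "(\<lambda>k. of_real (c ^ k / fact k - d ^ k / fact k) * z ^ k) sums (exp (of_real c * z) - exp (of_real d * z))"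
    unfolding e by (rule sums_diff[OF exp_sums(1) exp_sums(1)])
  show "summable (\<lambda>k. norm (of_real (c ^ k / fact k - d ^ k / fact k) * z ^ k))"
    unfolding e
    by (rule summable_comparison_test'[OF summable_add[OF exp_sums(2)[of c z] exp_sums(2)[of d z]]])
       (simp only: real_norm_def abs_norm_cancel norm_triangle_ineq4)
qed

text \<open>Stated over a general field to be used twice: at small real z to compare coefficients,
  and at z = i to evaluate. Absolute summability of \<open>y\<close> makes its series converge
  absolutely on the closed unit disc, boundary included.\<close>

lemma powser_product_sums:
  fixes z :: "'b::{real_normed_field, banach}"
  assumes "summable (\<lambda>k. \<bar>y k\<bar>)" "norm z \<le> 1" "summable (\<lambda>k. norm (of_real (g k) * z ^ k))"
  shows "(\<lambda>k. of_real (\<Sum>i\<le>k. y i * g (k - i)) * z ^ k) sums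
    ((\<Sum>k. of_real (y k) * z ^ k) * (\<Sum>k. of_real (g k) * z ^ k))"
proof -
  have Y: "summable (\<lambda>k. norm (of_real (y k) * z ^ k))"
    by (rule summable_comparison_test'[OF assms(1)])
       (use assms(2) in \<open>auto simp: norm_mult norm_power intro!: mult_left_le power_le_one\<close>)
  have "(of_real (y i) * z ^ i) * (of_real (g (k - i)) * z ^ (k - i)) = of_real (y i * g (k - i)) * z ^ k"
    if "i \<le> k" for i k
  proof -
    have "z ^ k = z ^ i * z ^ (k - i)" using that by (simp flip: power_add)
    then show ?thesis by (simp add: mult_ac)
  qed
  then have "(\<Sum>i\<le>k. (of_real (y i) * z ^ i) * (of_real (g (k - i)) * z ^ (k - i)))
      = of_real (\<Sum>i\<le>k. y i * g (k - i)) * z ^ k" for k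
    unfolding of_real_sum sum_distrib_right by (intro sum.cong) auto
  then show ?thesis
    using Cauchy_product_sums[OF Y assms(3)] by simp
qed

text \<open>An absolutely summable coefficient sequence would allow evaluation of the generating function
  identity at \<open>z = \<i>\<close>, where \<open>exp (pi * z) - exp (- pi * z)\<close> vanishes.\<close>

lemma (in triangular_pair) bch_off_diagonal_not_summable:
  assumes pi: "a + b = pi" and uv: "u / (2 * a) \<noteq> v / (2 * b)"
  shows "\<not> summable (\<lambda>k. \<bar>fst (\<integral>x. iter x k (\<lambda>_. (0, 1)) \<partial>I1)\<bar>)"
proof
  define y where "y k = fst (\<integral>x. iter x k (\<lambda>_. (0, 1)) \<partial>I1)" for k
  define k1 where "k1 = u / (2 * a)"
  define k2 where "k2 = v / (2 * b)"
  \<comment> \<open>Taylor coefficients: \<open>e1\<close> and \<open>e2\<close> of the two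
    differences of exponentials in the numerator X, \<open>g\<close> of exp(pi z) - exp(-pi z), and
    \<open>h\<close> of 2 pi X(z).\<close>
  define e1 where "e1 k = (a - b) ^ k / fact k - (- pi) ^ k / fact k" for k
  define e2 where "e2 k = pi ^ k / fact k - (a - b) ^ k / fact k" for k
  define g where "g k = pi ^ k / fact k - (- pi) ^ k / fact k" for k
  define h where "h k = 2 * pi * (k1 * e1 k + k2 * e2 k)" for k
  assume "summable (\<lambda>k. \<bar>fst (\<integral>x. iter x k (\<lambda>_. (0, 1)) \<partial>I1)\<bar>)"
  then have sy: "summable (\<lambda>k. \<bar>y k\<bar>)" by (simp add: y_def)
  \<comment> \<open>Small enough for the product of power series (\<open>norm z \<le> 1\<close>) and
    for the generating function; the summand 1 covers \<open>C = 0\<close>.\<close>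
  define \<eta> where "\<eta> = min 1 (1 / (2 * C + 1))"
  have \<eta>: "0 < \<eta>" using C_nonneg by (simp add: \<eta>_def)
  \<comment> \<open>Both sides of the generating function identity are power series near 0, so their
    coefficients agree. This form of the identity no longer refers to small z.\<close>
  have "(\<Sum>i\<le>k. y i * g (k - i)) - h k = 0" for k
  proof (rule powser_eq_0[OF \<eta>])
    fix z :: real assume z: "z \<noteq> 0" "\<bar>z\<bar> < \<eta>"
    have "\<bar>z\<bar> * (2 * C) \<le> \<bar>z\<bar> * (2 * C + 1)" by (intro mult_left_mono) auto
    also have "\<dots> < 1" using z C_nonneg by (simp add: \<eta>_def pos_less_divide_eq)
    finally have small: "\<bar>z\<bar> * (2 * C) < 1" .
    obtain S where S: "(\<lambda>k. y k * z ^ k) sums S"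
      "S * (exp (pi * z) - exp (- (pi * z))) = 2 * pi * bch_numerator a u b v z"
      using bch_generating_function[OF z(1) small] unfolding pi y_def .
    have z1: "norm z \<le> 1" using z by (simp add: \<eta>_def)
    have "(\<lambda>k. g k * z ^ k) sums (exp (pi * z) - exp (- (pi * z)))"
      using exp_diff_sums(1)[of pi "- pi" z] by (simp add: g_def)
    then have prod: "(\<lambda>k. (\<Sum>i\<le>k. y i * g (k - i)) * z ^ k) sums (2 * pi * bch_numerator a u b v z)"
      using powser_product_sums[of y z g, OF sy z1] exp_diff_sums(2)[of pi "- pi" z] S
      by (simp add: sums_iff g_def)
    have "(\<lambda>k. e1 k * z ^ k) sums (exp ((a - b) * z) - exp (- (pi * z)))"
      "(\<lambda>k. e2 k * z ^ k) sums (exp (pi * z) - exp ((a - b) * z))"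
      using exp_diff_sums(1)[of "a - b" "- pi" z] exp_diff_sums(1)[of pi "a - b" z]
      by (simp_all add: e1_def e2_def)
    then have "(\<lambda>k. 2 * pi * (k1 * (e1 k * z ^ k) + k2 * (e2 k * z ^ k))) sums
      (2 * pi * (k1 * (exp ((a - b) * z) - exp (- (pi * z))) + k2 * (exp (pi * z) - exp ((a - b) * z))))"
      by (intro sums_mult sums_add)
    moreover have "2 * pi * (k1 * (e1 k * z ^ k) + k2 * (e2 k * z ^ k)) = h k * z ^ k" for k
      by (simp add: h_def algebra_simps)
    moreover have "- (a + b) * z = - (pi * z)" using pi by (simp only: minus_mult_left)
    ultimately have "(\<lambda>k. h k * z ^ k) sums (2 * pi * bch_numerator a u b v z)"
      unfolding bch_numerator_def k1_def[symmetric] k2_def[symmetric] pi by simp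
    from sums_diff[OF prod this]
    show "(\<lambda>k. ((\<Sum>i\<le>k. y i * g (k - i)) - h k) * z ^ k) sums 0"
      by (simp add: left_diff_distrib)
  qed
  then have gh: "(\<Sum>i\<le>k. y i * g (k - i)) = h k" for k by simp
  define E where "E = exp (of_real (a - b) * \<i>)"
  \<comment> \<open>The eigenvalues collide at z = i: the series of \<open>g\<close> sums to 0
    there, hence so does its product with the series of \<open>y\<close>, and with it the series of
    \<open>h\<close>.\<close>
  have pi_i: "exp (of_real pi * \<i>) = -1" "exp (of_real (- pi) * \<i>) = -1"
    by (simp_all add: exp_minus)
  have "(\<lambda>k. of_real (g k) * \<i> ^ k) sums 0"
    using exp_diff_sums(1)[of pi "- pi" \<i>] unfolding pi_i g_def[symmetric] by simp
  then have h0: "(\<lambda>k. of_real (h k) * \<i> ^ k) sums 0"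
    using powser_product_sums[of y \<i> g, OF sy] exp_diff_sums(2)[of pi "- pi" \<i>]
    by (simp add: sums_iff g_def[symmetric] gh)
  moreover have "(\<lambda>k. of_real (e1 k) * \<i> ^ k) sums (E + 1)"
    using exp_diff_sums(1)[of "a - b" "- pi" \<i>] unfolding pi_i e1_def[symmetric] E_def[symmetric] by simp
  moreover have "(\<lambda>k. of_real (e2 k) * \<i> ^ k) sums (-1 - E)"
    using exp_diff_sums(1)[of pi "a - b" \<i>] unfolding pi_i e2_def[symmetric] E_def[symmetric] .
  ultimately have "(\<lambda>k. of_real (2 * pi) * (of_real k1 * (of_real (e1 k) * \<i> ^ k) + of_real k2 * (of_real (e2 k) * \<i> ^ k)))
      sums (of_real (2 * pi) * (of_real k1 * (E + 1) + of_real k2 * (-1 - E)))"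
    by (intro sums_mult sums_add)
  moreover have "of_real (2 * pi) * (of_real k1 * (of_real (e1 k) * \<i> ^ k) + of_real k2 * (of_real (e2 k) * \<i> ^ k))
      = of_real (h k) * \<i> ^ k" for k
    by (simp add: h_def algebra_simps)
  ultimately have "(\<lambda>k. of_real (h k) * \<i> ^ k) sums
      (of_real (2 * pi) * (of_real k1 * (E + 1) + of_real k2 * (-1 - E)))" by simp
  from sums_unique2[OF this h0] have "of_real k1 * (E + 1) + of_real k2 * (-1 - E) = 0" by simp
  \<comment> \<open>At z = i the two differences in the numerator are E + 1 and -(E + 1), so X(i)
    factors.\<close>
  then have "of_real (k1 - k2) * (E + 1) = 0"
    by (simp add: algebra_simps)
  moreover have "k1 - k2 \<noteq> 0" using uv by (simp add: k1_def k2_def)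
  ultimately have "E + 1 = 0" by (simp only: mult_eq_0_iff of_real_eq_0_iff simp_thms)
  moreover have "E = cis (a - b)" unfolding E_def cis_conv_exp by (simp add: mult.commute)
  ultimately have "Re (cis (a - b) + 1) = 0" by simp
  then have "cos (a - b) = -1" by simp
  then have "cos \<bar>a - b\<bar> = cos pi" by (simp add: cos_abs_real)
  \<comment> \<open>Since a, b > 0, the difference is smaller in modulus than the sum pi, so exp(i(a
    - b)) cannot be -1.\<close>
  moreover have "\<bar>a - b\<bar> < pi" using a b pi by linarith
  ultimately show False using cos_inj_pi[of "\<bar>a - b\<bar>" pi] by simp
qed


section \<open>Norms on upper triangular matrices\<close>

lemma bch_term_scaleR:
  fixes A B :: "'a::{real_normed_field, euclidean_space} ^ 'n ^ 'n"
  shows "bch_term (\<tau> *\<^sub>R A) (\<tau> *\<^sub>R B) k = \<tau> ^ k *\<^sub>R bch_term A B k"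
proof -
  have mult: "(\<tau> *\<^sub>R X) ** (c *\<^sub>R Y) = (\<tau> * c) *\<^sub>R (X ** Y)" for c and X Y :: "'a ^ 'n ^ 'n"
    by (simp add: vec_eq_iff matrix_matrix_mult_def scaleR_sum_right mult_ac)
  have "foldr (\<lambda>i M. (if t i < 1 then \<tau> *\<^sub>R A else \<tau> *\<^sub>R B) ** M) xs (mat 1)
      = \<tau> ^ length xs *\<^sub>R foldr (\<lambda>i M. (if t i < 1 then A else B) ** M) xs (mat 1)"
    for t :: "nat \<Rightarrow> real" and xs
    by (induction xs) (auto simp: mult)
  then have "ordered_product (\<lambda>t. if t < 1 then \<tau> *\<^sub>R A else \<tau> *\<^sub>R B) k t
      = \<tau> ^ k *\<^sub>R ordered_product (\<lambda>t. if t < 1 then A else B) k t" for t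
    by (simp add: ordered_product_def)
  then show ?thesis
    by (simp add: bch_term_def magnus_term_def scaleR_left_commute[of _ "\<tau> ^ k"] del: scaleR_scaleR)
qed

locale upper_triangular_norm =
  fixes N :: "'a::{real_normed_field, euclidean_space} ^ 2 ^ 2 \<Rightarrow> real"
  assumes norm: "algebra_norm_on upper_triangular N"
begin

lemma N_nonneg: "A \<in> upper_triangular \<Longrightarrow> 0 \<le> N A"
  and N_eq_0_iff: "A \<in> upper_triangular \<Longrightarrow> N A = 0 \<longleftrightarrow> A = 0"
  and N_triangle: "A \<in> upper_triangular \<Longrightarrow> B \<in> upper_triangular \<Longrightarrow> N (A + B) \<le> N A + N B"
  and N_mult: "A \<in> upper_triangular \<Longrightarrow> B \<in> upper_triangular \<Longrightarrow> N (A ** B) \<le> N A * N B"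
  and N_scale: "A \<in> upper_triangular \<Longrightarrow> N (\<chi> i j. c * A $ i $ j) = norm c * N A"
  using norm by (simp_all add: algebra_norm_on_def)

lemma N_scaleR:
  assumes "A \<in> upper_triangular"
  shows "N (c *\<^sub>R A) = \<bar>c\<bar> * N A"
proof -
  have "c *\<^sub>R A = (\<chi> i j. of_real c * A $ i $ j)"
    by (simp add: vec_eq_iff scaleR_conv_of_real[where 'a='a])
  then show ?thesis using N_scale[OF assms, of "of_real c"] by simp
qed

lemma upper_triangular_closed:
  assumes "A \<in> upper_triangular" "B \<in> upper_triangular"
  shows "A + B \<in> (upper_triangular :: ('a ^ 2 ^ 2) set)" "A - B \<in> (upper_triangular :: ('a ^ 2 ^ 2) set)"
    "c *\<^sub>R A \<in> (upper_triangular :: ('a ^ 2 ^ 2) set)"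
  using assms by (auto simp: upper_triangular_def)

lemma N_minus_commute:
  assumes "A \<in> upper_triangular" "B \<in> upper_triangular"
  shows "N (A - B) = N (B - A)"
  using N_scaleR[OF upper_triangular_closed(2)[OF assms], of "-1"] by simp

lemma N_diff_le:
  assumes "A \<in> upper_triangular" "B \<in> upper_triangular"
  shows "N (A - B) \<le> N A + N B" "\<bar>N A - N B\<bar> \<le> N (A - B)"
proof -
  have 0: "(0 :: 'a ^ 2 ^ 2) \<in> upper_triangular" by (simp add: upper_triangular_def)
  have "N (- B) = N B" using N_scaleR[OF assms(2), of "-1"] by simp
  moreover have "- B \<in> upper_triangular" using upper_triangular_closed(2)[OF 0 assms(2)] by simp
  ultimately show "N (A - B) \<le> N A + N B" using N_triangle[OF assms(1), of "- B"] by simp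
  have "N A \<le> N (A - B) + N B"
    using N_triangle[OF upper_triangular_closed(2)[OF assms] assms(2)] by simp
  moreover have "N B \<le> N (B - A) + N A"
    using N_triangle[OF upper_triangular_closed(2)[OF assms(2,1)] assms(1)] by simp
  ultimately show "\<bar>N A - N B\<bar> \<le> N (A - B)"
    using N_minus_commute[OF assms] by linarith
qed

text \<open>Multiplying by the diagonal matrix units on both sides isolates the off-diagonal entry.\<close>

lemma entry_le_N:
  assumes "A \<in> upper_triangular"
  shows "norm (A $ 1 $ 2) * N (mat22 0 1 0 0) \<le> N (mat22 1 0 0 0) * N (mat22 0 0 0 1) * N A"
proof -
  have u: "mat22 0 1 0 0 \<in> upper_triangular" "mat22 1 0 0 0 \<in> upper_triangular"
    "mat22 0 0 0 1 \<in> upper_triangular" by (simp_all add: upper_triangular_def)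
  have "mat22 1 0 0 0 ** A ** mat22 0 0 0 1 = (\<chi> i j. A $ 1 $ 2 * (mat22 0 1 0 0 :: 'a ^ 2 ^ 2) $ i $ j)"
    by (simp add: vec_eq_iff forall_2 matrix_matrix_mult_def sum_2)
  then have "norm (A $ 1 $ 2) * N (mat22 0 1 0 0) = N (mat22 1 0 0 0 ** A ** mat22 0 0 0 1)"
    using N_scale[OF u(1), of "A $ 1 $ 2"] by simp
  also have "\<dots> \<le> N (mat22 1 0 0 0 ** A) * N (mat22 0 0 0 1)"
    using assms by (intro N_mult u) (simp add: upper_triangular_def matrix_matrix_mult_def sum_2)
  also have "\<dots> \<le> (N (mat22 1 0 0 0) * N A) * N (mat22 0 0 0 1)"
    by (intro mult_right_mono N_mult u assms N_nonneg)
  finally show ?thesis by (simp add: mult_ac)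
qed

lemma N_mat22_0100_pos: "0 < N (mat22 0 1 0 0)"
proof -
  have "mat22 0 1 0 0 \<in> (upper_triangular :: ('a ^ 2 ^ 2) set)" by (simp add: upper_triangular_def)
  moreover have "(mat22 0 1 0 0 :: 'a ^ 2 ^ 2) \<noteq> 0" by (simp add: vec_eq_iff forall_2)
  ultimately show ?thesis using N_nonneg N_eq_0_iff by (metis less_eq_real_def)
qed

lemma not_abs_convergent_if_entries_not_summable:
  assumes "\<And>k. \<mu> (Suc k) \<in> upper_triangular" "\<not> summable (\<lambda>k. norm (\<mu> (Suc k) $ 1 $ 2))"
  shows "\<not> series_abs_converges N \<mu>"
proof
  let ?c = "N (mat22 1 0 0 0) * N (mat22 0 0 0 1) / N (mat22 0 1 0 0)"
  assume "series_abs_converges N \<mu>"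
  then have "summable (\<lambda>k. ?c * N (\<mu> (Suc k)))"
    unfolding series_abs_converges_def by (rule summable_mult)
  moreover have "norm (norm (\<mu> (Suc k) $ 1 $ 2)) \<le> ?c * N (\<mu> (Suc k))" for k
    using entry_le_N[OF assms(1)] N_mat22_0100_pos by (simp add: pos_le_divide_eq mult_ac)
  ultimately have "summable (\<lambda>k. norm (\<mu> (Suc k) $ 1 $ 2))"
    by (rule summable_comparison_test')
  with assms(2) show False by simp
qed

text \<open>Each term is the difference of two consecutive partial sums, whose distances to the
  limit are bounded. Through this, nonconvergence in (b) follows from unboundedness of the
  terms.\<close>

lemma series_converges_imp_terms_bounded:
  assumes "\<And>k. \<mu> (Suc k) \<in> upper_triangular" "series_converges_on upper_triangular N \<mu>"
  shows "terms_bounded N \<mu>"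
proof -
  obtain L where L: "L \<in> upper_triangular" "(\<lambda>n. N ((\<Sum>k = 1..n. \<mu> k) - L)) \<longlonglongrightarrow> 0"
    using assms(2) by (auto simp: series_converges_on_def)
  have "Bseq (\<lambda>n. N ((\<Sum>k = 1..n. \<mu> k) - L))"
    using L(2) by (intro convergent_imp_Bseq) (auto simp: convergent_def)
  then obtain K where K: "\<And>n. \<bar>N ((\<Sum>k = 1..n. \<mu> k) - L)\<bar> \<le> K"
    by (auto simp: Bseq_def)
  have S: "(\<Sum>k = 1..n. \<mu> k) - L \<in> upper_triangular" for n
  proof -
    have "(\<Sum>k = 1..n. \<mu> k) \<in> upper_triangular"
      by (induction n) (use assms(1) in \<open>auto simp: upper_triangular_def\<close>)
    then show ?thesis by (rule upper_triangular_closed(2)[OF _ L(1)])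
  qed
  have "N (\<mu> (Suc n)) \<le> K + K" for n
  proof -
    have "\<mu> (Suc n) = ((\<Sum>k = 1..Suc n. \<mu> k) - L) - ((\<Sum>k = 1..n. \<mu> k) - L)" by simp
    then have "N (\<mu> (Suc n)) \<le> N ((\<Sum>k = 1..Suc n. \<mu> k) - L) + N ((\<Sum>k = 1..n. \<mu> k) - L)"
      using N_diff_le(1)[OF S[of "Suc n"] S[of n]] by metis
    then show ?thesis using K[of "Suc n"] K[of n] by linarith
  qed
  then have "\<forall>k\<ge>1. N (\<mu> k) \<le> K + K"
    by (metis One_nat_def Suc_le_D)
  then show ?thesis unfolding terms_bounded_def by blast
qed

end

section \<open>The matrices \<open>M1\<close> and \<open>M2\<close>, and the choice of the
  parameters\<close>

lemma M1_upper_triangular: "M1 \<alpha> \<epsilon> \<in> upper_triangular"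
  and M2_upper_triangular: "M2 \<alpha> \<epsilon> \<in> upper_triangular"
  by (simp_all add: M1_def M2_def upper_triangular_def)

lemma bch_off_diagonal_entry_not_summable:
  assumes "\<alpha> \<in> {-pi<..<pi}" "\<epsilon> \<noteq> 0"
  shows "\<not> summable (\<lambda>k. norm (bch_term (M1 \<alpha> \<epsilon>) (M2 \<alpha> \<epsilon>) (Suc k) $ 1 $ 2
    :: 'a::{real_normed_field, euclidean_space}))"
proof -
  define a where "a = (pi - \<alpha>) / 2"
  define b where "b = (pi + \<alpha>) / 2"
  have ab: "0 < a" "0 < b" "a + b = pi" using assms by (simp_all add: a_def b_def field_simps)
  obtain C where "bounded_linear_pair (triangular_action a (- (b * \<epsilon>))) (triangular_action b (a * \<epsilon>)) C"
    using bounded_linear_pair_exists[OF bounded_linear_triangular_action bounded_linear_triangular_action] .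
  then interpret triangular_pair a "- (b * \<epsilon>)" b "a * \<epsilon>" C
    by (intro triangular_pair.intro ab)
  have "norm (bch_term (M1 \<alpha> \<epsilon>) (M2 \<alpha> \<epsilon>) (Suc k) $ 1 $ 2 :: 'a) = \<bar>fst (\<integral>x. iter x k (\<lambda>_. (0, 1)) \<partial>I1)\<bar>" for k
    using bch_term_off_diagonal[where 'a='a, of k] by (simp add: M1_def M2_def a_def b_def)
  \<comment> \<open>Equality would mean that the two matrices commute. The off-diagonal entries
    \<epsilon>(-b, a) are orthogonal to the diagonal ones (a, b), so the determinant a v - b u is
    \<epsilon> (a^2 + b^2), which is nonzero.\<close>
  moreover have "- (b * \<epsilon>) / (2 * a) \<noteq> a * \<epsilon> / (2 * b)"
  proof
    assume "- (b * \<epsilon>) / (2 * a) = a * \<epsilon> / (2 * b)"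
    then have "\<epsilon> * (a * a + b * b) = 0" using ab by (simp add: field_simps)
    moreover have "0 < a * a + b * b" using ab by (intro add_pos_pos mult_pos_pos)
    ultimately show False using assms(2) by simp
  qed
  ultimately show ?thesis
    using bch_off_diagonal_not_summable[OF ab(3)] by simp
qed

lemma algebra_norm_on_upper_triangular_cong:
  fixes N N' :: "'a::real_normed_field ^ 2 ^ 2 \<Rightarrow> real"
  assumes "algebra_norm_on upper_triangular N'" "\<And>A. A \<in> upper_triangular \<Longrightarrow> N A = N' A"
  shows "algebra_norm_on upper_triangular N"
proof -
  have "A + B \<in> upper_triangular" "A ** B \<in> upper_triangular" "(\<chi> i j. c * A $ i $ j) \<in> upper_triangular"
    if "A \<in> upper_triangular" "B \<in> upper_triangular" for A B :: "'a ^ 2 ^ 2" and c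
    using that by (auto simp: upper_triangular_def matrix_matrix_mult_def sum_2)
  then show ?thesis using assms unfolding algebra_norm_on_def by simp
qed

theorem theorem1p5:
  fixes N :: "'a::{real_normed_field, euclidean_space} ^ 2 ^ 2 \<Rightarrow> real"
    and r \<delta> :: real
  assumes norm_N:
      "(\<exists>p::ereal. 1 \<le> p \<and> (\<forall>A\<in>upper_triangular. N A = lp_operator_norm p A)) \<or>
       (algebra_norm_on upper_triangular N \<and> N (mat22 1 0 0 (-1)) = 1)"
    and "r > 0" and "\<delta> > 0"
  shows "(\<exists>\<alpha>\<in>{-pi..pi}. \<exists>\<epsilon>. \<epsilon> \<noteq> 0 \<and>
            N (M1 \<alpha> \<epsilon>) / N (M2 \<alpha> \<epsilon>) = r \<and>
            N (M1 \<alpha> \<epsilon>) + N (M2 \<alpha> \<epsilon>) < pi + \<delta> \<and>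
            \<not> series_abs_converges N (bch_term (M1 \<alpha> \<epsilon>) (M2 \<alpha> \<epsilon>))) \<and>
         (\<exists>A\<in>upper_triangular. \<exists>B\<in>upper_triangular.
            N A / N B = r \<and> N A + N B = pi + \<delta> \<and>
            \<not> series_converges_on upper_triangular N (bch_term A B) \<and>
            \<not> terms_bounded N (bch_term A B))"
proof -
  let ?D = "mat22 1 0 0 (-1) :: 'a ^ 2 ^ 2" and ?E = "mat22 0 1 0 0 :: 'a ^ 2 ^ 2"
  have D: "?D \<in> upper_triangular" and E: "?E \<in> upper_triangular" by (simp_all add: upper_triangular_def)
  have "algebra_norm_on upper_triangular N \<and> N ?D = 1"
    using norm_N
  proof
    assume "\<exists>p::ereal. 1 \<le> p \<and> (\<forall>A\<in>upper_triangular. N A = lp_operator_norm p A)"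
    then obtain p :: ereal where p: "1 \<le> p" "\<And>A. A \<in> upper_triangular \<Longrightarrow> N A = lp_operator_norm p A" by blast
    have "algebra_norm_on upper_triangular (lp_operator_norm p :: 'a ^ 2 ^ 2 \<Rightarrow> real)"
      by (rule algebra_norm_on_lp_operator_norm[OF p(1)])
    then have "algebra_norm_on upper_triangular N"
      using p(2) by (rule algebra_norm_on_upper_triangular_cong)
    then show ?thesis using lp_operator_norm_diag[OF p(1)] p(2)[OF D] by simp
  qed
  then have alg: "algebra_norm_on upper_triangular N" and ND: "N ?D = 1" by auto
  interpret upper_triangular_norm N by (rule upper_triangular_norm.intro[OF alg])
  define e where "e = N ?E"
  have e: "0 < e" using N_mat22_0100_pos by (simp add: e_def)
  \<comment> \<open>With e the norm of the off-diagonal matrix unit, this puts \<epsilon> e strictly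
    below r, 1/r and \<delta>/pi. The first two bounds give \<open>f\<close> opposite signs at pi
    and -pi, where one of the matrices is diagonal; the third keeps pi + pi \<epsilon> e, an upper
    bound for the sum of the norms, below pi + \<delta>.\<close>
  define \<epsilon> where "\<epsilon> = min r (min (1 / r) (\<delta> / pi)) / (2 * e)"
  have \<epsilon>: "0 < \<epsilon>" "\<epsilon> * e < r" "r * (\<epsilon> * e) < 1" "pi * (\<epsilon> * e) < \<delta>"
  proof -
    define m where "m = min r (min (1 / r) (\<delta> / pi))"
    have m: "0 < m" using assms by (simp add: m_def)
    then show "0 < \<epsilon>" using e by (simp add: \<epsilon>_def m_def)
    have "\<epsilon> * e = m / 2" using e by (simp add: \<epsilon>_def m_def)
    then have h: "\<epsilon> * e < m" using m by linarith
    then show "\<epsilon> * e < r" by (simp add: m_def)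
    have "\<epsilon> * e < 1 / r" "\<epsilon> * e < \<delta> / pi" using h by (simp_all add: m_def)
    then show "r * (\<epsilon> * e) < 1" "pi * (\<epsilon> * e) < \<delta>"
      using assms(2) by (simp_all add: pos_less_divide_eq mult.commute)
  qed
  have M1: "M1 \<alpha> \<epsilon> = ((pi - \<alpha>) / 2) *\<^sub>R ?D + (- ((pi + \<alpha>) / 2 * \<epsilon>)) *\<^sub>R ?E" for \<alpha>
    by (simp add: vec_eq_iff forall_2 M1_def of_real_def)
  have M2: "M2 \<alpha> \<epsilon> = ((pi + \<alpha>) / 2) *\<^sub>R ?D + ((pi - \<alpha>) / 2 * \<epsilon>) *\<^sub>R ?E" for \<alpha>
    by (simp add: vec_eq_iff forall_2 M2_def of_real_def)
  have comb: "N (x *\<^sub>R ?D + y *\<^sub>R ?E) \<le> \<bar>x\<bar> + \<bar>y\<bar> * e" for x y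
    using N_triangle[of "x *\<^sub>R ?D" "y *\<^sub>R ?E"] N_scaleR[OF D] N_scaleR[OF E] ND
      upper_triangular_closed(3)[OF D D] upper_triangular_closed(3)[OF E E] by (simp add: e_def)
  define f where "f \<alpha> = N (M1 \<alpha> \<epsilon>) - r * N (M2 \<alpha> \<epsilon>)" for \<alpha>
  have comb_diff: "N ((x *\<^sub>R ?D + y *\<^sub>R ?E) - (x' *\<^sub>R ?D + y' *\<^sub>R ?E)) \<le> (1 + \<epsilon> * e) * d"
    if "\<bar>x - x'\<bar> = d / 2" "\<bar>y - y'\<bar> = d / 2 * \<epsilon>" for x y x' y' d
  proof -
    have "(x *\<^sub>R ?D + y *\<^sub>R ?E) - (x' *\<^sub>R ?D + y' *\<^sub>R ?E) = (x - x') *\<^sub>R ?D + (y - y') *\<^sub>R ?E"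
      by (simp add: algebra_simps)
    then have "N ((x *\<^sub>R ?D + y *\<^sub>R ?E) - (x' *\<^sub>R ?D + y' *\<^sub>R ?E)) \<le> d / 2 + d / 2 * \<epsilon> * e"
      using comb[of "x - x'" "y - y'"] that by simp
    also have "\<dots> = (1 + \<epsilon> * e) * (d / 2)" by (simp add: algebra_simps)
    also have "\<dots> \<le> (1 + \<epsilon> * e) * d"
      using \<epsilon>(1) e that(1) by (intro mult_left_mono) auto
    finally show ?thesis .
  qed
  \<comment> \<open>\<open>N\<close> is controlled only on the upper triangular matrices, so
    continuity in \<alpha> is derived from the reverse triangle inequality there.\<close>
  have lip: "\<bar>N (M1 \<alpha> \<epsilon>) - N (M1 \<beta> \<epsilon>)\<bar> \<le> (1 + \<epsilon> * e) * \<bar>\<alpha> - \<beta>\<bar>"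
    "\<bar>N (M2 \<alpha> \<epsilon>) - N (M2 \<beta> \<epsilon>)\<bar> \<le> (1 + \<epsilon> * e) * \<bar>\<alpha> - \<beta>\<bar>" for \<alpha> \<beta>
  proof -
    have e1: "\<bar>x * \<epsilon> - y * \<epsilon>\<bar> = \<bar>x - y\<bar> * \<epsilon>" for x y :: real
      using \<epsilon>(1) by (simp add: left_diff_distrib[symmetric] abs_mult)
    have e2: "\<bar>(pi - \<alpha>) / 2 - (pi - \<beta>) / 2\<bar> = \<bar>\<alpha> - \<beta>\<bar> / 2"
      "\<bar>(pi + \<alpha>) / 2 - (pi + \<beta>) / 2\<bar> = \<bar>\<alpha> - \<beta>\<bar> / 2"
      by (simp_all add: diff_divide_distrib[symmetric] abs_minus_commute)
    have "N (M1 \<alpha> \<epsilon> - M1 \<beta> \<epsilon>) \<le> (1 + \<epsilon> * e) * \<bar>\<alpha> - \<beta>\<bar>"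
      unfolding M1 by (rule comb_diff[OF e2(1)]) (simp only: minus_diff_minus abs_minus_cancel e1 e2)
    then show "\<bar>N (M1 \<alpha> \<epsilon>) - N (M1 \<beta> \<epsilon>)\<bar> \<le> (1 + \<epsilon> * e) * \<bar>\<alpha> - \<beta>\<bar>"
      by (rule order_trans[OF N_diff_le(2)[OF M1_upper_triangular M1_upper_triangular]])
    have "N (M2 \<alpha> \<epsilon> - M2 \<beta> \<epsilon>) \<le> (1 + \<epsilon> * e) * \<bar>\<alpha> - \<beta>\<bar>"
      unfolding M2 by (rule comb_diff[OF e2(2)]) (simp only: e1 e2)
    then show "\<bar>N (M2 \<alpha> \<epsilon>) - N (M2 \<beta> \<epsilon>)\<bar> \<le> (1 + \<epsilon> * e) * \<bar>\<alpha> - \<beta>\<bar>"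
      by (rule order_trans[OF N_diff_le(2)[OF M2_upper_triangular M2_upper_triangular]])
  qed
  have cont: "continuous_on {-pi..pi} g" if "\<And>\<alpha> \<beta>. \<bar>g \<alpha> - g \<beta>\<bar> \<le> (1 + \<epsilon> * e) * \<bar>\<alpha> - \<beta>\<bar>" for g :: "real \<Rightarrow> real"
    using \<epsilon> e that
    by (intro lipschitz_on_continuous_on[of "1 + \<epsilon> * e"] lipschitz_onI) (auto simp: dist_real_def)
  have "continuous_on {-pi..pi} f"
    unfolding f_def[abs_def] by (intro continuous_intros cont lip)
  moreover have f_right: "f pi < 0"
  proof -
    have "f pi = pi * (\<epsilon> * e - r)"
      unfolding f_def M1 M2 using \<epsilon> N_scaleR[OF D] N_scaleR[OF E] ND by (simp add: e_def algebra_simps del: scaleR_minus_left)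
    then show ?thesis using \<epsilon> by (simp add: mult_less_0_iff)
  qed
  moreover have f_left: "0 < f (- pi)"
  proof -
    have "f (- pi) = pi * (1 - r * (\<epsilon> * e))"
      unfolding f_def M1 M2 using \<epsilon> N_scaleR[OF D] N_scaleR[OF E] ND by (simp add: e_def algebra_simps)
    then show ?thesis using \<epsilon> by simp
  qed
  ultimately obtain \<alpha> where \<alpha>: "- pi \<le> \<alpha>" "\<alpha> \<le> pi" "f \<alpha> = 0"
    using IVT2'[of f pi 0 "- pi"] by force
  \<comment> \<open>Both endpoint values of \<open>f\<close> are nonzero, so its zero is interior
    and both diagonal entries (pi - \<alpha>)/2 and (pi + \<alpha>)/2 are positive.\<close>
  then have \<alpha>': "\<alpha> \<in> {-pi<..<pi}" using f_right f_left by (auto simp: less_le)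
  let ?A = "M1 \<alpha> \<epsilon> :: 'a ^ 2 ^ 2" and ?B = "M2 \<alpha> \<epsilon> :: 'a ^ 2 ^ 2"
  have "?B $ 1 $ 1 \<noteq> 0" using \<alpha>' by (simp add: M2_def add_eq_0_iff)
  then have "N ?B \<noteq> 0" using N_eq_0_iff[OF M2_upper_triangular] by auto
  then have B_pos: "0 < N ?B" using N_nonneg[OF M2_upper_triangular] by (simp add: less_le)
  have ratio: "N ?A = r * N ?B" using \<alpha>(3) by (simp add: f_def)
  have sum_pos: "0 < N ?A + N ?B" using ratio B_pos assms(2) by (simp add: add_pos_pos)
  have sum_less: "N ?A + N ?B < pi + \<delta>"
  proof -
    have "N ?A \<le> (pi - \<alpha>) / 2 + (pi + \<alpha>) / 2 * (\<epsilon> * e)"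
      unfolding M1 using comb[of "(pi - \<alpha>) / 2" "- ((pi + \<alpha>) / 2 * \<epsilon>)"] \<alpha> \<epsilon> by (simp add: abs_mult mult.assoc)
    moreover have "N ?B \<le> (pi + \<alpha>) / 2 + (pi - \<alpha>) / 2 * (\<epsilon> * e)"
      unfolding M2 using comb[of "(pi + \<alpha>) / 2" "(pi - \<alpha>) / 2 * \<epsilon>"] \<alpha> \<epsilon> by (simp add: abs_mult mult.assoc)
    ultimately have "N ?A + N ?B \<le> pi + pi * (\<epsilon> * e)" by (simp add: field_simps)
    then show ?thesis using \<epsilon>(4) by linarith
  qed
  have ut: "bch_term X Y (Suc k) \<in> upper_triangular" if "X \<in> upper_triangular" "Y \<in> upper_triangular"
    for X Y :: "'a ^ 2 ^ 2" and k
    using that by (rule bch_term_upper_triangular)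
  have abs: "\<not> series_abs_converges N (bch_term ?A ?B)"
    using ut[OF M1_upper_triangular M2_upper_triangular] bch_off_diagonal_entry_not_summable[OF \<alpha>', of \<epsilon>] \<epsilon>(1)
    by (intro not_abs_convergent_if_entries_not_summable) auto
  define \<tau> where "\<tau> = (pi + \<delta>) / (N ?A + N ?B)"
  have \<tau>: "1 < \<tau>" using sum_pos sum_less by (simp add: \<tau>_def)
  have uA: "\<tau> *\<^sub>R ?A \<in> upper_triangular" and uB: "\<tau> *\<^sub>R ?B \<in> upper_triangular"
    using upper_triangular_closed(3) M1_upper_triangular M2_upper_triangular by blast+
  have NA: "N (\<tau> *\<^sub>R ?A) = \<tau> * N ?A" and NB: "N (\<tau> *\<^sub>R ?B) = \<tau> * N ?B"
    using \<tau> by (simp_all add: N_scaleR M1_upper_triangular M2_upper_triangular)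
  have unb: "\<not> terms_bounded N (bch_term (\<tau> *\<^sub>R ?A) (\<tau> *\<^sub>R ?B))"
  proof
    assume "terms_bounded N (bch_term (\<tau> *\<^sub>R ?A) (\<tau> *\<^sub>R ?B))"
    then obtain K where K: "\<And>k. 1 \<le> k \<Longrightarrow> N (\<tau> ^ k *\<^sub>R bch_term ?A ?B k) \<le> K"
      by (auto simp: terms_bounded_def bch_term_scaleR)
    \<comment> \<open>The term of index k scales by \<tau>^k with \<tau> > 1, so bounded scaled
      terms would force geometric decay of the original ones and hence absolute convergence.\<close>
    have le: "N (bch_term ?A ?B (Suc k)) \<le> K * (1 / \<tau>) ^ k" for k
    proof -
      note u = ut[OF M1_upper_triangular M2_upper_triangular, of \<alpha> \<epsilon> \<alpha> \<epsilon> k]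
      have "\<tau> ^ k * N (bch_term ?A ?B (Suc k)) \<le> \<tau> ^ Suc k * N (bch_term ?A ?B (Suc k))"
        using \<tau> N_nonneg[OF u] by (intro mult_right_mono power_increasing) auto
      also have "\<dots> \<le> K" using K[of "Suc k"] N_scaleR[OF u, of "\<tau> ^ Suc k"] \<tau> by simp
      finally show ?thesis using \<tau> by (simp add: power_divide pos_le_divide_eq mult.commute)
    qed
    have "summable (\<lambda>k. K * (1 / \<tau>) ^ k)"
      by (rule summable_mult, rule summable_geometric) (use \<tau> in simp)
    then have "summable (\<lambda>k. N (bch_term ?A ?B (Suc k)))"
      by (rule summable_comparison_test')
         (use le N_nonneg[OF ut[OF M1_upper_triangular M2_upper_triangular]] in auto)
    with abs show False by (simp add: series_abs_converges_def)
  qed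
  have not_conv: "\<not> series_converges_on upper_triangular N (bch_term (\<tau> *\<^sub>R ?A) (\<tau> *\<^sub>R ?B))"
    using series_converges_imp_terms_bounded[of "bch_term (\<tau> *\<^sub>R ?A) (\<tau> *\<^sub>R ?B)", OF ut[OF uA uB]] unb by blast
  have "N (\<tau> *\<^sub>R ?A) / N (\<tau> *\<^sub>R ?B) = r"
    using NA NB ratio B_pos \<tau> by simp
  moreover have "N (\<tau> *\<^sub>R ?A) + N (\<tau> *\<^sub>R ?B) = pi + \<delta>"
    using sum_pos unfolding NA NB distrib_left[symmetric] by (simp add: \<tau>_def)
  ultimately have "\<exists>A\<in>upper_triangular. \<exists>B\<in>upper_triangular. N A / N B = r \<and> N A + N B = pi + \<delta> \<and>
      \<not> series_converges_on upper_triangular N (bch_term A B) \<and> \<not> terms_bounded N (bch_term A B)"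
    using not_conv unb uA uB by blast
  moreover have "N ?A / N ?B = r" using ratio B_pos by simp
  then have "\<exists>\<epsilon>. \<epsilon> \<noteq> 0 \<and> N (M1 \<alpha> \<epsilon>) / N (M2 \<alpha> \<epsilon>) = r \<and> N (M1 \<alpha> \<epsilon>) + N (M2 \<alpha> \<epsilon>) < pi + \<delta> \<and>
      \<not> series_abs_converges N (bch_term (M1 \<alpha> \<epsilon>) (M2 \<alpha> \<epsilon>))"
    using \<epsilon>(1) sum_less abs by (intro exI[of _ \<epsilon>]) simp
  moreover have "\<alpha> \<in> {-pi..pi}" using \<alpha> by simp
  ultimately show ?thesis by blast
qed

end
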